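(* Let $A_0,\ldots,A_N,B_1,\ldots,B_N\in\mathbb{R}^{n\times n}$, $\mu\in\mathbb{R}$, and for delays $h_1,\ldots,h_N\ge0$ with $\bar h=\max_ih_i$ consider the system $$\dot X(t)=A_0X(t)+X(t)A_0^T+\sum_{i=1}^NA_iX(t)A_i^T+\mu X(t)+\sum_{i=1}^NB_iX(t-h_i)B_i^T,\quad t\ge0,\qquad X(s)=\Xi(s),\ s\in[-\bar h,0],\qquad(\ast)$$ with initial condition $\Xi\in C([-\bar h,0],\mathbb{S}^n_{\succeq0})$. Define on $\mathbb{S}^n$ the operators $\mathcal{C}(X)=A_0X+XA_0^T+\sum_{i=1}^NA_iXA_i^T+\mu X$, $\mathcal{C}^*(P)=A_0^TP+PA_0+\sum_{i=1}^NA_i^TPA_i+\mu P$, $\mathcal{H}_i(X)=B_iXB_i^T$ and $\mathcal{H}_i^*(P)=B_i^TPB_i$. The following statements are equivalent: (a) The system $(\ast)$ is exponentially stable for all delay values $h_i\ge0$, $i=1,\ldots,N$. (b) The system $(\ast)$ with zero delays ($h_i=0$, $i=1,\ldots,N$) is exponentially stable. (c) There exist matrices $P,Q_1,\ldots,Q_N\in\mathbb{S}^n_{\succ0}$ such that $$\mathcal{C}^*(P)+\sum_{i=1}^NQ_i\prec0\quad\text{and}\quad\mathcal{H}_i^*(P)-Q_i\preceq0,\quad i=1,\ldots,N.$$ (d) $\mathrm{sp}\big(\mathcal{C}+\sum_{i=1}^N\mathcal{H}_i\big)\subset\mathbb{C}_{<0}$, where $\mathrm{sp}\big(\mathcal{C}+\sum_{i}\mathcal{H}_i\big):=\{\lambda\in\mathbb{C}:\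 \mathcal{C}(X)+\sum_{i=1}^N\mathcal{H}_i(X)=\lambda X\text{ for some }X\in\mathbb{S}^n,\ X\ne0\}$.
   Context: $\mathbb{S}^n$, $\mathbb{S}^n_{\succeq0}$, $\mathbb{S}^n_{\succ0}$ denote the real symmetric, positive semidefinite and positive definite $n\times n$ matrices; $\preceq,\prec$ refer to the Loewner order. $\mathbb{C}_{<0}$ is the open left half-plane. For given delays, the system is exponentially stable if there exist $\alpha>0$, $\beta\ge1$ such that $\|X(t)\|\le\beta e^{-\alpha t}\max_{s\in[-\bar h,0]}\|\Xi(s)\|$ for all $t\ge0$ and all initial conditions $\Xi\in C([-\bar h,0],\mathbb{S}^n_{\succeq0})$ (the constants may depend on the delays). *)

theory Defs
  imports "HOL-Analysis.Analysis"
begin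

text \<open>
  Throughout, \<open>A i\<close> is used for \<open>i = 0,\<dots>,N\<close>, whereas \<open>B i\<close>, \<open>Q i\<close> and the delays \<open>h i\<close> are used
  for \<open>i = 1,\<dots>,N\<close> only; values at other indices are irrelevant.
\<close>

definition sym_mats :: "(real^'n^'n) set" where
  "sym_mats = {X. transpose X = X}"

definition psd_mats :: "(real^'n^'n) set" where
  "psd_mats = {X \<in> sym_mats. \<forall>v. 0 \<le> v \<bullet> (X *v v)}"

definition pd_mats :: "(real^'n^'n) set" where
  "pd_mats = {X \<in> sym_mats. \<forall>v. v \<noteq> 0 \<longrightarrow> 0 < v \<bullet> (X *v v)}"

definition loewner_le :: "real^'n^'n \<Rightarrow> real^'n^'n \<Rightarrow> bool" (infix "\<preceq>\<^sub>L" 50) where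
  "X \<preceq>\<^sub>L Y \<longleftrightarrow> Y - X \<in> psd_mats"

definition loewner_less :: "real^'n^'n \<Rightarrow> real^'n^'n \<Rightarrow> bool" (infix "\<prec>\<^sub>L" 50) where
  "X \<prec>\<^sub>L Y \<longleftrightarrow> Y - X \<in> pd_mats"

definition opC :: "nat \<Rightarrow> (nat \<Rightarrow> real^'n^'n) \<Rightarrow> real \<Rightarrow> real^'n^'n \<Rightarrow> real^'n^'n" where
  "opC N A \<mu> X = A 0 ** X + X ** transpose (A 0)
      + (\<Sum>i=1..N. A i ** X ** transpose (A i)) + \<mu> *\<^sub>R X"

definition opC_adj :: "nat \<Rightarrow> (nat \<Rightarrow> real^'n^'n) \<Rightarrow> real \<Rightarrow> real^'n^'n \<Rightarrow> real^'n^'n" where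
  "opC_adj N A \<mu> P = transpose (A 0) ** P + P ** A 0
      + (\<Sum>i=1..N. transpose (A i) ** P ** A i) + \<mu> *\<^sub>R P"

definition opH :: "(nat \<Rightarrow> real^'n^'n) \<Rightarrow> nat \<Rightarrow> real^'n^'n \<Rightarrow> real^'n^'n" where
  "opH B i X = B i ** X ** transpose (B i)"

definition opH_adj :: "(nat \<Rightarrow> real^'n^'n) \<Rightarrow> nat \<Rightarrow> real^'n^'n \<Rightarrow> real^'n^'n" where
  "opH_adj B i P = transpose (B i) ** P ** B i"

definition max_delay :: "nat \<Rightarrow> (nat \<Rightarrow> real) \<Rightarrow> real" where
  "max_delay N h = Max (h ` {1..N})"

text \<open>
  The derivative at \<open>t = 0\<close> is the right derivative. Only the values of \<open>X\<close> on \<open>[-max_delay N h, \<infinity>)\<close>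
  matter.
\<close>

definition is_solution ::
  "nat \<Rightarrow> (nat \<Rightarrow> real^'n^'n) \<Rightarrow> (nat \<Rightarrow> real^'n^'n) \<Rightarrow> real \<Rightarrow> (nat \<Rightarrow> real)
    \<Rightarrow> (real \<Rightarrow> real^'n^'n) \<Rightarrow> (real \<Rightarrow> real^'n^'n) \<Rightarrow> bool" where
  "is_solution N A B \<mu> h \<Xi> X \<longleftrightarrow>
     (\<forall>s \<in> {-max_delay N h..0}. X s = \<Xi> s) \<and>
     (\<forall>t\<ge>0. (X has_vector_derivative
        (opC N A \<mu> (X t) + (\<Sum>i=1..N. opH B i (X (t - h i))))) (at t within {0..}))"

definition exp_stable ::
  "nat \<Rightarrow> (nat \<Rightarrow> real^'n^'n) \<Rightarrow> (nat \<Rightarrow> real^'n^'n) \<Rightarrow> real \<Rightarrow> (nat \<Rightarrow> real) \<Rightarrow> bool" where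
  "exp_stable N A B \<mu> h \<longleftrightarrow>
     (\<exists>\<alpha> \<beta>. \<alpha> > 0 \<and> \<beta> \<ge> 1 \<and>
       (\<forall>\<Xi> X. continuous_on {-max_delay N h..0} \<Xi> \<and> \<Xi> ` {-max_delay N h..0} \<subseteq> psd_mats \<and>
              is_solution N A B \<mu> h \<Xi> X \<longrightarrow>
          (\<forall>t\<ge>0. norm (X t) \<le> \<beta> * exp (- \<alpha> * t) * (SUP s\<in>{-max_delay N h..0}. norm (\<Xi> s)))))"

definition lmi_feasible ::
  "nat \<Rightarrow> (nat \<Rightarrow> real^'n^'n) \<Rightarrow> (nat \<Rightarrow> real^'n^'n) \<Rightarrow> real \<Rightarrow> bool" where
  "lmi_feasible N A B \<mu> \<longleftrightarrow>
     (\<exists>P \<in> pd_mats. \<exists>Q. (\<forall>i\<in>{1..N}. Q i \<in> pd_mats) \<and>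
        opC_adj N A \<mu> P + (\<Sum>i=1..N. Q i) \<prec>\<^sub>L 0 \<and>
        (\<forall>i\<in>{1..N}. opH_adj B i P - Q i \<preceq>\<^sub>L 0))"

text \<open>
  For an operator \<open>L\<close> on the real space of symmetric matrices, \<open>sp_real_eigvec L\<close> is the set of
  complex \<open>z\<close> with \<open>L X = z X\<close> for a nonzero \<^emph>\<open>real\<close> symmetric \<open>X\<close> (the equation is read
  entrywise in the complex numbers), which forces \<open>z\<close> to be real. The usual
  spectrum of \<open>L\<close>, that of its complexification \<open>L (X + \<i>Y) = L X + \<i> L Y\<close>, is \<open>sp_complexified L\<close>.
\<close>

definition sp_real_eigvec :: "(real^'n^'n \<Rightarrow> real^'n^'n) \<Rightarrow> complex set" where
  "sp_real_eigvec L = {z. \<exists>X \<in> sym_mats. X \<noteq> 0 \<and>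
     (\<forall>i j. complex_of_real (L X $ i $ j) = z * complex_of_real (X $ i $ j))}"

definition sp_complexified :: "(real^'n^'n \<Rightarrow> real^'n^'n) \<Rightarrow> complex set" where
  "sp_complexified L = {z. \<exists>X \<in> sym_mats. \<exists>Y \<in> sym_mats. (X \<noteq> 0 \<or> Y \<noteq> 0) \<and>
     (\<forall>i j. Complex (L X $ i $ j) (L Y $ i $ j) = z * Complex (X $ i $ j) (Y $ i $ j))}"

end

theory Submission
  imports Defs
begin

text \<open>
  Write \<open>L = C + \<Sum> H\<^sub>i\<close>. All four conditions are equivalent to the existence of \<open>P \<succ> 0\<close> with
  \<open>L\<^sup>* P \<prec> 0\<close>; given such a \<open>P\<close>, condition (c) holds with \<open>Q\<^sub>i = H\<^sub>i\<^sup>* P + \<delta> I\<close>.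

  If no such \<open>P\<close> exists, a separating hyperplane gives \<open>X \<succeq> 0\<close>, \<open>X \<noteq> 0\<close> with \<open>L X \<succeq> 0\<close>. For large \<open>s\<close>
  the resolvent \<open>inverse (s - L)\<close> preserves positivity and commutes with \<open>L\<close>, so Brouwer's theorem,
  applied to the normalised resolvent on \<open>{X \<succeq> 0. tr X = 1, L X \<succeq> 0}\<close>, yields an eigenvector
  \<open>X \<succeq> 0\<close> of \<open>L\<close> with eigenvalue \<open>r \<ge> 0\<close>. This refutes (d), and \<open>exp (r t) X\<close> refutes (b).

  Conversely, by the same alternative for the adjoint, \<open>L\<^sup>* P \<prec> 0\<close> provides \<open>Z \<succ> 0\<close> with \<open>L Z \<prec> 0\<close>.
  For small \<open>\<alpha> > 0\<close> the curve \<open>c exp (- \<alpha> t) Z\<close> is then a strict supersolution of the delay equation,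
  and a first-exit argument shows that \<open>c exp (- \<alpha> t) Z \<plusminus> X(t)\<close> stays positive definite for every
  solution \<open>X\<close> with symmetric initial data. That gives (a), and also (d), because the real and
  imaginary parts of \<open>exp (z t) (X + \<i> Y)\<close> solve the undelayed equation.
\<close>

subsection \<open>Quadratic forms of matrices\<close>

text \<open>As simp rules these would rewrite \<open>transpose C *v v\<close>, the form in which
  congruences act on vectors below, into a product with \<open>v*\<close>.\<close>

declare transpose_matrix_vector [simp del] vector_transpose_matrix [simp del]

definition quad_form :: "real^'n^'n \<Rightarrow> real^'n \<Rightarrow> real" where
  "quad_form X v = v \<bullet> (X *v v)"

text \<open>The dyad of \<open>v\<close> with itself. Pairing with it in the entrywise (trace) inner
  product gives the quadratic form, so linearity in the matrix, continuity and the norm bound come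
  from the inner product.\<close>

definition rank_one :: "real^'n \<Rightarrow> real^'n^'n" where
  "rank_one v = (\<chi> i j. v $ i * v $ j)"

lemma inner_matrix: "(X :: real^'n^'n) \<bullet> Y = (\<Sum>i\<in>UNIV. \<Sum>j\<in>UNIV. X $ i $ j * Y $ i $ j)"
  by (simp add: inner_vec_def)

lemma quad_form_eq_inner: "quad_form X v = X \<bullet> rank_one v"
  unfolding quad_form_def inner_matrix rank_one_def
  by (simp add: inner_vec_def matrix_vector_mult_def sum_distrib_left mult_ac)

lemma inner_rank_one: "rank_one u \<bullet> rank_one v = (u \<bullet> v)\<^sup>2"
  unfolding inner_matrix rank_one_def
  by (simp add: inner_vec_def power2_eq_square sum_product mult_ac)

lemma norm_rank_one: "norm (rank_one v) = (norm v)\<^sup>2"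
  by (simp add: norm_eq_sqrt_inner inner_rank_one)

lemma abs_quad_form_le: "\<bar>quad_form X v\<bar> \<le> norm X * (norm v)\<^sup>2"
  using Cauchy_Schwarz_ineq2[of X "rank_one v"] by (simp add: quad_form_eq_inner norm_rank_one)

lemma bounded_linear_quad_form: "bounded_linear (\<lambda>X. quad_form X v)"
  unfolding quad_form_eq_inner by (rule bounded_linear_inner_left)

lemma quad_form_add [simp]: "quad_form (X + Y) v = quad_form X v + quad_form Y v"
  and quad_form_diff [simp]: "quad_form (X - Y) v = quad_form X v - quad_form Y v"
  and quad_form_minus [simp]: "quad_form (- X) v = - quad_form X v"
  and quad_form_scaleR [simp]: "quad_form (c *\<^sub>R X) v = c * quad_form X v"
  and quad_form_sum: "quad_form (sum F I) v = (\<Sum>i\<in>I. quad_form (F i) v)"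
  and quad_form_zero [simp]: "quad_form 0 v = 0"
  by (simp_all add: quad_form_eq_inner inner_add_left inner_diff_left inner_sum_left)

lemma quad_form_zero_vector [simp]: "quad_form X 0 = 0"
  by (simp add: quad_form_def)

lemma quad_form_mat_1 [simp]: "quad_form (mat 1) v = v \<bullet> v"
  by (simp add: quad_form_def)

lemma quad_form_scaleR_vector [simp]: "quad_form X (c *\<^sub>R v) = c\<^sup>2 * quad_form X v"
  by (simp add: quad_form_def matrix_vector_mult_scaleR power2_eq_square)

lemma inner_matrix_vector_mult: "v \<bullet> (C *v w) = (transpose C *v v) \<bullet> (w :: real^'n)"
  by (simp add: dot_lmul_matrix transpose_matrix_vector)

lemma quad_form_congruence: "quad_form (C ** X ** transpose C) v = quad_form X (transpose C *v v)"
  unfolding quad_form_def matrix_vector_mul_assoc[symmetric] by (rule inner_matrix_vector_mult)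

lemma quad_form_transpose: "quad_form (transpose X) v = quad_form X v"
  unfolding quad_form_def by (subst inner_matrix_vector_mult) (simp add: inner_commute)

lemma continuous_on_quad_form [continuous_intros]:
  assumes "continuous_on S f" "continuous_on S g"
  shows "continuous_on S (\<lambda>x. quad_form (f x) (g x))"
proof -
  have "continuous_on S (\<lambda>x. rank_one (g x))"
    unfolding rank_one_def
    by (intro continuous_on_vec_lambda continuous_on_mult continuous_on_component assms(2))
  then show ?thesis
    unfolding quad_form_eq_inner by (rule continuous_on_inner[OF assms(1)])
qed

lemma sym_mats_iff_components: "X \<in> sym_mats \<longleftrightarrow> (\<forall>i j. X $ i $ j = X $ j $ i)"
  unfolding sym_mats_def transpose_def by (auto simp: vec_eq_iff)

lemma transpose_sum: "transpose (sum F I) = (\<Sum>i\<in>I. transpose (F i))"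
  by (simp add: transpose_def vec_eq_iff)

lemma transpose_add: "transpose (X + Y) = transpose X + transpose (Y :: real^'n^'m)"
  and transpose_diff: "transpose (X - Y) = transpose X - transpose (Y :: real^'n^'m)"
  and transpose_minus: "transpose (- X) = - transpose (X :: real^'n^'m)"
  and transpose_zero: "transpose (0 :: real^'n^'m) = 0"
  and transpose_rank_one: "transpose (rank_one v) = rank_one v"
  by (simp_all add: transpose_def rank_one_def vec_eq_iff mult.commute)

lemma psd_mats_iff: "X \<in> psd_mats \<longleftrightarrow> X \<in> sym_mats \<and> (\<forall>v. 0 \<le> quad_form X v)"
  by (simp add: psd_mats_def quad_form_def)

lemma pd_mats_iff: "X \<in> pd_mats \<longleftrightarrow> X \<in> sym_mats \<and> (\<forall>v. v \<noteq> 0 \<longrightarrow> 0 < quad_form X v)"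
  by (simp add: pd_mats_def quad_form_def)

lemma sym_mats_add: "X \<in> sym_mats \<Longrightarrow> Y \<in> sym_mats \<Longrightarrow> X + Y \<in> sym_mats"
  and sym_mats_diff: "X \<in> sym_mats \<Longrightarrow> Y \<in> sym_mats \<Longrightarrow> X - Y \<in> sym_mats"
  and sym_mats_minus: "X \<in> sym_mats \<Longrightarrow> - X \<in> sym_mats"
  and sym_mats_scaleR: "X \<in> sym_mats \<Longrightarrow> c *\<^sub>R X \<in> sym_mats"
  and sym_mats_zero: "0 \<in> sym_mats"
  and sym_mats_mat_1: "mat 1 \<in> sym_mats"
  and sym_mats_rank_one: "rank_one v \<in> sym_mats"
  by (simp_all add: sym_mats_def transpose_add transpose_diff transpose_minus transpose_scalar
      transpose_rank_one transpose_zero)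

lemma closed_sym_mats: "closed (sym_mats :: (real^'n^'n) set)"
proof -
  have "sym_mats = (\<Inter>i j. {X :: real^'n^'n. X $ i $ j = X $ j $ i})"
    by (auto simp: sym_mats_iff_components)
  also have "closed \<dots>"
    by (intro closed_INT ballI closed_Collect_eq continuous_intros)
  finally show ?thesis .
qed

text \<open>The quotient of the two forms is continuous on the compact unit sphere and homogeneous
  of degree 0. The outcome is a nonnegative form \<open>Y - m *\<^sub>R P\<close> with null vector
  \<open>v\<close>, exactly the situation in which quasi-monotonicity applies.\<close>

lemma generalized_Rayleigh_minimum:
  fixes P Y :: "real^'n^'n"
  assumes "P \<in> pd_mats"
  obtains v m where "v \<noteq> 0" "quad_form Y v = m * quad_form P v"
    "\<And>u. m * quad_form P u \<le> quad_form Y u"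
proof -
  have Ppos: "0 < quad_form P v" if "v \<noteq> 0" for v
    using assms that by (simp add: pd_mats_iff)
  let ?S = "sphere (0 :: real^'n) 1"
  have "\<exists>v\<in>?S. \<forall>u\<in>?S. quad_form Y v / quad_form P v \<le> quad_form Y u / quad_form P u"
  proof (intro continuous_attains_inf compact_sphere continuous_intros ballI)
    show "?S \<noteq> {}" by (simp add: sphere_eq_empty)
    show "quad_form P v \<noteq> 0" if "v \<in> ?S" for v
      using Ppos[of v] that by force
  qed
  then obtain v where v: "norm v = 1"
    and min: "\<And>u. norm u = 1 \<Longrightarrow> quad_form Y v / quad_form P v \<le> quad_form Y u / quad_form P u"
    by auto
  define m where "m = quad_form Y v / quad_form P v"
  have v0: "v \<noteq> 0" using v by auto
  show ?thesis
  proof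
    show "v \<noteq> 0" by fact
    show "quad_form Y v = m * quad_form P v"
      using Ppos[OF v0] by (simp add: m_def)
    show "m * quad_form P u \<le> quad_form Y u" for u
    proof (cases "u = 0")
      case False
      define w where "w = (1 / norm u) *\<^sub>R u"
      have "norm w = 1" "w \<noteq> 0" and u: "u = norm u *\<^sub>R w"
        using False by (auto simp: w_def)
      then have "m * quad_form P w \<le> quad_form Y w"
        using min[of w] Ppos[of w] by (simp add: m_def field_simps)
      then have "(norm u)\<^sup>2 * (m * quad_form P w) \<le> (norm u)\<^sup>2 * quad_form Y w"
        by (intro mult_left_mono) auto
      then show ?thesis
        by (subst (1 2) u) (simp add: mult_ac)
    qed auto
  qed
qed

text \<open>Symmetry is left out so that the set is open in the space of all matrices, which the
  first-exit and continuity arguments use.\<close>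

definition form_pos :: "(real^'n^'n) set" where
  "form_pos = {X. \<forall>v. v \<noteq> 0 \<longrightarrow> 0 < quad_form X v}"

lemma pd_mats_eq: "pd_mats = sym_mats \<inter> form_pos"
  by (auto simp: pd_mats_iff form_pos_def)

lemma form_pos_lower_bound:
  fixes X :: "real^'n^'n"
  assumes "X \<in> form_pos"
  obtains m where "m > 0" "\<And>v. m * (norm v)\<^sup>2 \<le> quad_form X v"
proof -
  have "mat 1 \<in> (pd_mats :: (real^'n^'n) set)"
    by (simp add: pd_mats_iff sym_mats_mat_1)
  then obtain v m where v: "v \<noteq> 0" "quad_form X v = m * quad_form (mat 1) v"
    "\<And>u. m * quad_form (mat 1) u \<le> quad_form X u"
    by (rule generalized_Rayleigh_minimum[where Y = X]) blast
  have "0 < m * (v \<bullet> v)" using v(1,2) assms by (auto simp: form_pos_def)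
  then have "m > 0" by (meson inner_ge_zero not_less zero_less_mult_iff)
  with v(3) that show ?thesis by (simp add: power2_norm_eq_inner)
qed

text \<open>A perturbation of norm below the coercivity constant \<open>m\<close> changes the form
  at \<open>v\<close> by less than \<open>m * (norm v)\<^sup>2\<close>.\<close>

lemma open_form_pos: "open (form_pos :: (real^'n^'n) set)"
  unfolding open_contains_ball
proof
  fix X :: "real^'n^'n" assume "X \<in> form_pos"
  then obtain m where m: "m > 0" "\<And>v. m * (norm v)\<^sup>2 \<le> quad_form X v"
    by (rule form_pos_lower_bound) blast
  have "ball X m \<subseteq> form_pos"
  proof
    fix Y assume "Y \<in> ball X m"
    then have Y: "norm (X - Y) < m" by (simp add: dist_norm)
    have "0 < quad_form Y v" if "v \<noteq> 0" for v
    proof -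
      have "norm (X - Y) * (norm v)\<^sup>2 < m * (norm v)\<^sup>2"
        using Y that by simp
      then show ?thesis
        using m(2)[of v] abs_quad_form_le[of "X - Y" v] by simp
    qed
    then show "Y \<in> form_pos" by (simp add: form_pos_def)
  qed
  with m(1) show "\<exists>e>0. ball X e \<subseteq> form_pos" by blast
qed

subsection \<open>The operators and their quasi-monotonicity\<close>

lemma nonneg_linear_imp_zero:
  fixes b q :: real
  assumes "\<And>t. 0 \<le> t * b + t\<^sup>2 * q" and q: "q \<ge> 0"
  shows "b = 0"
proof -
  \<comment> \<open>The denominator \<open>q + 1\<close> instead of \<open>2 * q\<close> avoids a
    case distinction at \<open>q = 0\<close>.\<close>
  have "0 \<le> (- b / (q + 1)) * b + (- b / (q + 1))\<^sup>2 * q" by fact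
  also have "\<dots> = - (b / (q + 1))\<^sup>2"
  proof -
    define c where "c = b / (q + 1)"
    have b: "b = c * (q + 1)" and c: "- b / (q + 1) = - c" using q by (simp_all add: c_def)
    have "(- c) * b + (- c)\<^sup>2 * q = - c\<^sup>2"
      unfolding b by (simp add: algebra_simps power2_eq_square)
    then show ?thesis by (simp only: c flip: c_def)
  qed
  finally have "b / (q + 1) = 0" by simp
  then show ?thesis using q by simp
qed

text \<open>The vector \<open>v\<close> minimises the form, so the first variation in every
  direction \<open>w\<close> vanishes. Both cross terms appear because \<open>D\<close> may be
  nonsymmetric.\<close>

lemma quad_form_zero_kernel:
  assumes pos: "\<And>u. 0 \<le> quad_form D u" and zero: "quad_form D v = 0"
  shows "w \<bullet> (D *v v) + v \<bullet> (D *v w) = 0"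
proof (rule nonneg_linear_imp_zero)
  show "0 \<le> t * (w \<bullet> (D *v v) + v \<bullet> (D *v w)) + t\<^sup>2 * quad_form D w" for t
    using pos[of "v + t *\<^sub>R w"] zero
    by (simp add: quad_form_def algebra_simps inner_add_left inner_add_right power2_eq_square)
qed (rule pos)

lemma quad_form_opC: "quad_form (opC N A \<mu> X) v =
   (transpose (A 0) *v v) \<bullet> (X *v v) + v \<bullet> (X *v (transpose (A 0) *v v))
     + (\<Sum>i=1..N. quad_form X (transpose (A i) *v v)) + \<mu> * quad_form X v"
proof -
  have "quad_form (A 0 ** X) v = (transpose (A 0) *v v) \<bullet> (X *v v)"
    unfolding quad_form_def
    by (subst matrix_vector_mul_assoc[symmetric]) (simp add: inner_matrix_vector_mult)
  moreover have "quad_form (X ** transpose (A 0)) v = v \<bullet> (X *v (transpose (A 0) *v v))"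
    unfolding quad_form_def by (subst matrix_vector_mul_assoc[symmetric]) simp
  ultimately show ?thesis
    by (simp add: opC_def quad_form_sum quad_form_congruence)
qed

text \<open>At a null vector of a nonnegative form the terms with \<open>A 0\<close> cancel by the
  first variation, the term with \<mu> is zero, and congruences preserve nonnegativity. Thus
  \<open>opC\<close>, though not a positive operator, points inward on the boundary of the
  cone.\<close>

lemma opC_quasi_monotone:
  assumes "\<And>u. 0 \<le> quad_form D u" "quad_form D v = 0"
  shows "0 \<le> quad_form (opC N A \<mu> D) v"
  unfolding quad_form_opC
  using quad_form_zero_kernel[OF assms, of "transpose (A 0) *v v"] assms
  by (simp add: sum_nonneg)

lemma quad_form_opH: "quad_form (opH B i X) v = quad_form X (transpose (B i) *v v)"
  by (simp add: opH_def quad_form_congruence)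

definition opL ::
  "nat \<Rightarrow> (nat \<Rightarrow> real^'n^'n) \<Rightarrow> (nat \<Rightarrow> real^'n^'n) \<Rightarrow> real \<Rightarrow> real^'n^'n \<Rightarrow> real^'n^'n" where
  "opL N A B \<mu> X = opC N A \<mu> X + (\<Sum>i=1..N. opH B i X)"

lemma opL_quasi_monotone:
  assumes "\<And>u. 0 \<le> quad_form D u" "quad_form D v = 0"
  shows "0 \<le> quad_form (opL N A B \<mu> D) v"
  using opC_quasi_monotone[OF assms, of N A \<mu>]
  by (simp add: opL_def quad_form_sum quad_form_opH sum_nonneg assms(1))

section \<open>Linearity, symmetry and adjoints of the operators\<close>

lemma linear_matrix_mult_left: "linear (\<lambda>X. (C :: real^'n^'n) ** X)"
  by (rule linearI) (simp_all add: matrix_matrix_mult_def vec_eq_iff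
      sum_distrib_left sum.distrib algebra_simps)

lemma linear_matrix_mult_right: "linear (\<lambda>X. X ** (C :: real^'n^'n))"
  by (rule linearI) (simp_all add: matrix_matrix_mult_def vec_eq_iff
      sum_distrib_left sum.distrib algebra_simps)

lemma linear_congruence: "linear (\<lambda>X. C ** X ** transpose (C :: real^'n^'n))"
  using linear_compose[OF linear_matrix_mult_left linear_matrix_mult_right] by (simp add: o_def)

lemma linear_opC: "linear (opC N A \<mu>)"
  unfolding opC_def[abs_def]
  by (intro linear_compose_add linear_compose_sum ballI linear_congruence
      linear_matrix_mult_left linear_matrix_mult_right linear_compose_scale_right linear_id[unfolded id_def])

lemma linear_opH: "linear (opH B i)"
  unfolding opH_def[abs_def] by (rule linear_congruence)

lemma linear_opL: "linear (opL N A B \<mu>)"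
  unfolding opL_def[abs_def] by (intro linear_compose_add linear_compose_sum ballI linear_opC linear_opH)

lemma transpose_congruence:
  fixes C X :: "real^'n^'n"
  shows "transpose (C ** X ** transpose C) = C ** transpose X ** transpose C"
  by (simp add: matrix_transpose_mul matrix_mul_assoc)

lemma opC_transpose: "opC N A \<mu> (transpose X) = transpose (opC N A \<mu> X)"
  by (simp add: opC_def transpose_add transpose_sum transpose_scalar
      matrix_transpose_mul matrix_mul_assoc)

lemma opH_transpose: "opH B i (transpose X) = transpose (opH B i X)"
  by (simp add: opH_def transpose_congruence)

lemma opL_transpose: "opL N A B \<mu> (transpose X) = transpose (opL N A B \<mu> X)"
  by (simp add: opL_def opC_transpose opH_transpose transpose_add transpose_sum)

lemma opH_sym: "X \<in> sym_mats \<Longrightarrow> opH B i X \<in> sym_mats"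
  using opH_transpose[of B i X] by (simp add: sym_mats_def)

lemma opL_sym: "X \<in> sym_mats \<Longrightarrow> opL N A B \<mu> X \<in> sym_mats"
  using opL_transpose[of N A B \<mu> X] by (simp add: sym_mats_def)

lemma inner_matrix_mult_left:
  fixes C X Y :: "real^'n^'n"
  shows "(C ** X) \<bullet> Y = X \<bullet> (transpose C ** Y)"
proof -
  have "(C ** X) \<bullet> Y = (\<Sum>i\<in>UNIV. \<Sum>j\<in>UNIV. \<Sum>k\<in>UNIV. C $ i $ k * X $ k $ j * Y $ i $ j)"
    by (simp add: inner_matrix matrix_matrix_mult_def sum_distrib_right)
  also have "\<dots> = (\<Sum>i\<in>UNIV. \<Sum>k\<in>UNIV. \<Sum>j\<in>UNIV. C $ i $ k * X $ k $ j * Y $ i $ j)"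
    by (intro sum.cong refl sum.swap)
  also have "\<dots> = (\<Sum>k\<in>UNIV. \<Sum>i\<in>UNIV. \<Sum>j\<in>UNIV. C $ i $ k * X $ k $ j * Y $ i $ j)"
    by (rule sum.swap)
  also have "\<dots> = (\<Sum>k\<in>UNIV. \<Sum>j\<in>UNIV. \<Sum>i\<in>UNIV. C $ i $ k * X $ k $ j * Y $ i $ j)"
    by (intro sum.cong refl sum.swap)
  also have "\<dots> = X \<bullet> (transpose C ** Y)"
    by (simp add: inner_matrix matrix_matrix_mult_def transpose_def sum_distrib_left mult_ac)
  finally show ?thesis .
qed

lemma inner_transpose:
  fixes X Y :: "real^'n^'n"
  shows "transpose X \<bullet> transpose Y = X \<bullet> Y"
  unfolding inner_matrix transpose_def by (simp, rule sum.swap)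

lemma inner_matrix_mult_right:
  fixes C X Y :: "real^'n^'n"
  shows "(X ** C) \<bullet> Y = X \<bullet> (Y ** transpose C)"
proof -
  have "(X ** C) \<bullet> Y = (transpose C ** transpose X) \<bullet> transpose Y"
    by (simp add: inner_transpose flip: matrix_transpose_mul)
  also have "\<dots> = transpose X \<bullet> transpose (Y ** transpose C)"
    by (simp add: inner_matrix_mult_left matrix_transpose_mul)
  finally show ?thesis by (simp add: inner_transpose)
qed

lemma inner_congruence:
  fixes C X Y :: "real^'n^'n"
  shows "(C ** X ** transpose C) \<bullet> Y = X \<bullet> (transpose C ** Y ** C)"
  by (simp add: inner_matrix_mult_right[of "C ** X"] inner_matrix_mult_left[of C] matrix_mul_assoc)

text \<open>The adjoint is the same operator with transposed coefficients, so every fact about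
  \<open>opL\<close> holds for the adjoint as well.\<close>

lemma inner_opL:
  "opL N A B \<mu> X \<bullet> Y = X \<bullet> opL N (\<lambda>i. transpose (A i)) (\<lambda>i. transpose (B i)) \<mu> Y"
  by (simp add: opL_def opC_def opH_def inner_add_left inner_add_right inner_sum_left
      inner_sum_right inner_congruence inner_matrix_mult_left[of "A 0"]
      inner_matrix_mult_right[of _ "transpose (A 0)"])

subsection \<open>Theorem of the alternative and nonnegative eigenvectors\<close>

lemma scaled_bound_imp_nonpos:
  fixes x b :: real
  assumes "\<And>k. k > 0 \<Longrightarrow> k * x \<le> b"
  shows "x \<le> 0"
proof (rule ccontr)
  assume "\<not> x \<le> 0"
  then have "x > 0" by simp
  with assms[of "(\<bar>b\<bar> + 1) / x"] show False by simp
qed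

lemma quad_form_rank_one: "quad_form (rank_one w) v = (w \<bullet> v)\<^sup>2"
  by (simp add: quad_form_eq_inner inner_rank_one)

text \<open>Self-duality of the semidefinite cone: test against
  \<open>k *\<^sub>R rank_one v + mat 1\<close> and let \<open>k\<close> grow.\<close>

lemma quad_form_nonneg_if_inner_pd_nonneg:
  fixes X :: "real^'n^'n"
  assumes "\<And>P. P \<in> pd_mats \<Longrightarrow> 0 \<le> X \<bullet> P"
  shows "0 \<le> quad_form X v"
proof -
  have "k * (- quad_form X v) \<le> X \<bullet> mat 1" if "k > 0" for k
  proof -
    have "k *\<^sub>R rank_one v + mat 1 \<in> pd_mats"
      using that by (auto simp: pd_mats_iff sym_mats_add sym_mats_scaleR sym_mats_rank_one
          sym_mats_mat_1 quad_form_rank_one add_nonneg_pos)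
    from assms[OF this] show ?thesis
      by (simp add: inner_add_right quad_form_eq_inner)
  qed
  then have "- quad_form X v \<le> 0" by (rule scaled_bound_imp_nonpos)
  then show ?thesis by simp
qed

lemma mat_1_pd: "mat 1 \<in> pd_mats"
  by (simp add: pd_mats_iff sym_mats_mat_1)

lemma convex_sym_mats: "convex sym_mats"
  by (auto simp: convex_def sym_mats_add sym_mats_scaleR)

lemma convex_form_pos: "convex form_pos"
  unfolding convex_alt form_pos_def
proof (clarsimp)
  fix X Y :: "real^'a^'a" and u :: real and v :: "real^'a"
  assume *: "\<forall>v. v \<noteq> 0 \<longrightarrow> 0 < quad_form X v" "\<forall>v. v \<noteq> 0 \<longrightarrow> 0 < quad_form Y v"
    "0 \<le> u" "u \<le> 1" "v \<noteq> 0"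
  have "convex {0::real<..}" by simp
  with * show "0 < (1 - u) * quad_form X v + u * quad_form Y v"
    unfolding convex_alt by auto
qed

lemma Lyapunov_alternative:
  fixes f g :: "real^'n^'n \<Rightarrow> real^'n^'n"
  assumes f: "linear f" and adj: "\<And>X Y. f X \<bullet> Y = X \<bullet> g Y"
    and none: "\<And>P. P \<in> pd_mats \<Longrightarrow> - f P \<notin> form_pos"
  obtains X where "X \<in> psd_mats" "X \<noteq> 0" "\<And>v. 0 \<le> quad_form (g X) v"
proof -
  let ?S = "uminus ` (form_pos :: (real^'n^'n) set)" and ?T = "f ` pd_mats"
  have "convex ?S" "convex ?T"
    unfolding pd_mats_eq
    by (intro convex_negations convex_linear_image[OF f] convex_Int convex_sym_mats convex_form_pos)+
  moreover have "?S \<noteq> {}" "?T \<noteq> {}"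
    using mat_1_pd by (force simp: pd_mats_eq)+
  moreover have "?S \<inter> ?T = {}"
    using none by (auto simp: minus_equation_iff[of _ "f _"])
  ultimately obtain a b where a: "a \<noteq> 0" and aS: "\<And>M. M \<in> ?S \<Longrightarrow> a \<bullet> M \<le> b"
    and aT: "\<And>M. M \<in> ?T \<Longrightarrow> b \<le> a \<bullet> M"
    using separating_hyperplane_sets[of ?S ?T] by metis
  \<comment> \<open>Both sets are closed under positive scaling, so the separating constant
    \<open>b\<close> may be replaced by 0.\<close>
  have pos: "0 \<le> a \<bullet> M" if M: "M \<in> form_pos" for M
  proof -
    have "k * (- (a \<bullet> M)) \<le> b" if "k > 0" for k
    proof -
      have "k *\<^sub>R M \<in> form_pos" using M that by (simp add: form_pos_def)
      then show ?thesis using aS[of "- (k *\<^sub>R M)"] by simp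
    qed
    then have "- (a \<bullet> M) \<le> 0" by (rule scaled_bound_imp_nonpos)
  then show ?thesis by simp
  qed
  have pos': "0 \<le> a \<bullet> f P" if P: "P \<in> pd_mats" for P
  proof -
    have "k * (- (a \<bullet> f P)) \<le> - b" if "k > 0" for k
    proof -
      have "k *\<^sub>R P \<in> pd_mats" using P that by (simp add: pd_mats_iff sym_mats_scaleR)
      then show ?thesis using aT[OF imageI, of "k *\<^sub>R P"] by (simp add: linear_cmul[OF f])
    qed
    then have "- (a \<bullet> f P) \<le> 0" by (rule scaled_bound_imp_nonpos)
  then show ?thesis by simp
  qed
  \<comment> \<open>The separating functional is symmetric because \<open>form_pos\<close> is invariant under adding
    antisymmetric matrices.\<close>
  define K where "K = a - transpose a"
  have K: "k * (- (a \<bullet> K)) \<le> a \<bullet> mat 1" for k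
  proof -
    have "mat 1 + k *\<^sub>R K \<in> form_pos"
      by (simp add: form_pos_def K_def quad_form_transpose)
    from pos[OF this] show ?thesis by (simp add: inner_add_right)
  qed
  have "- (a \<bullet> K) \<le> 0" by (rule scaled_bound_imp_nonpos[OF K])
  moreover have "a \<bullet> K \<le> 0"
    by (rule scaled_bound_imp_nonpos[where b = "a \<bullet> mat 1"]) (use K[of "- k" for k] in simp)
  ultimately have "a \<bullet> K = 0" by simp
  \<comment> \<open>Since \<open>K\<close> is antisymmetric, \<open>K \<bullet> K\<close> equals
    twice \<open>a \<bullet> K\<close>, which has just been shown to vanish.\<close>
  moreover have "transpose a \<bullet> K = - (a \<bullet> K)"
    using inner_transpose[of a "transpose K"]
    by (simp add: K_def transpose_diff inner_diff_right)
  ultimately have "K \<bullet> K = 0" by (simp add: K_def inner_diff_left)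
  then have "a \<in> sym_mats" by (simp add: K_def sym_mats_def)
  then have "a \<in> psd_mats"
    using quad_form_nonneg_if_inner_pd_nonneg[of a] pos by (auto simp: psd_mats_iff pd_mats_eq)
  moreover have "0 \<le> quad_form (g a) v" for v
    using quad_form_nonneg_if_inner_pd_nonneg[of "g a"] pos'
    by (metis adj inner_commute)
  ultimately show ?thesis using that a by blast
qed

text \<open>The inner product with \<open>mat 1\<close> is the trace; on the semidefinite cone it
  controls the norm.\<close>

lemma inner_mat_1: "X \<bullet> mat 1 = (\<Sum>i\<in>UNIV. quad_form (X :: real^'n^'n) (axis i 1))"
  by (simp add: inner_matrix quad_form_def mat_def matrix_vector_mult_basis inner_axis'
      column_def if_distrib cong: if_cong)

text \<open>Polarisation writes each entry of \<open>X\<close> through the form at sums and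
  differences of two basis vectors; the parallelogram law for \<open>D\<close> bounds these by the
  trace of \<open>D\<close>. The factor counts the entries.\<close>

lemma norm_le_inner_mat_1:
  fixes X D :: "real^'n^'n"
  assumes X: "X \<in> sym_mats" and le: "\<And>v. \<bar>quad_form X v\<bar> \<le> quad_form D v"
  shows "norm X \<le> (CARD('n))\<^sup>2 * (D \<bullet> mat 1)"
proof -
  have D: "0 \<le> quad_form D v" for v using le[of v] by linarith
  have Dle: "quad_form D (axis i 1) \<le> D \<bullet> mat 1" for i
    unfolding inner_mat_1 by (rule member_le_sum) (auto simp: D)
  have entry: "\<bar>X $ i $ j\<bar> \<le> D \<bullet> mat 1" for i j
  proof -
    let ?a = "axis i 1 :: real^'n" and ?b = "axis j 1 :: real^'n"
    have ab: "?a \<bullet> (X *v ?b) = X $ i $ j"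
      by (simp add: matrix_vector_mult_basis inner_axis' column_def)
    have "?b \<bullet> (X *v ?a) = ?a \<bullet> (X *v ?b)"
      using X inner_matrix_vector_mult[of ?b X ?a] by (simp add: sym_mats_def inner_commute)
    then have "4 * (?a \<bullet> (X *v ?b)) = quad_form X (?a + ?b) - quad_form X (?a - ?b)"
      by (simp add: quad_form_def algebra_simps inner_add_left inner_add_right inner_diff_left
          inner_diff_right)
    moreover have "quad_form D (?a + ?b) + quad_form D (?a - ?b)
        = 2 * quad_form D ?a + 2 * quad_form D ?b"
      by (simp add: quad_form_def algebra_simps inner_add_left inner_add_right inner_diff_left
          inner_diff_right)
    ultimately show ?thesis
      unfolding ab using le[of "?a + ?b"] le[of "?a - ?b"] Dle[of i] Dle[of j] by linarith
  qed
  have "norm X \<le> (\<Sum>i\<in>UNIV. norm (X $ i))"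
    by (simp add: norm_vec_def L2_set_le_sum)
  also have "\<dots> \<le> (\<Sum>i\<in>(UNIV :: 'n set). \<Sum>j\<in>(UNIV :: 'n set). D \<bullet> mat 1)"
    by (intro sum_mono order_trans[OF norm_le_l1_cart] entry)
  finally show ?thesis by (simp add: power2_eq_square mult_ac)
qed

lemma psd_norm_le: "X \<in> psd_mats \<Longrightarrow> norm X \<le> (CARD('n))\<^sup>2 * (X \<bullet> mat 1)"
  for X :: "real^'n^'n"
  by (rule norm_le_inner_mat_1) (auto simp: psd_mats_iff)

lemma psd_inner_mat_1_pos: "X \<in> psd_mats \<Longrightarrow> X \<noteq> 0 \<Longrightarrow> 0 < X \<bullet> mat 1"
  for X :: "real^'n^'n"
  using psd_norm_le[of X] by (smt (verit) mult_nonneg_nonpos norm_eq_zero norm_ge_zero zero_le_power2 of_nat_0_le_iff zero_le_power)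

text \<open>The constraint that \<open>L X\<close> be nonnegative survives the resolvent because the
  two commute. Kept in the domain of the Brouwer map, it makes the eigenvalue nonnegative.\<close>

lemma nonneg_eigenvector_psd:
  fixes L :: "real^'n^'n \<Rightarrow> real^'n^'n"
  assumes L: "linear L"
    and sym: "\<And>X. L (transpose X) = transpose (L X)"
    and qm: "\<And>D v. (\<And>u. 0 \<le> quad_form D u) \<Longrightarrow> quad_form D v = 0 \<Longrightarrow> 0 \<le> quad_form (L D) v"
    and X0: "X0 \<in> psd_mats" "X0 \<noteq> 0" "\<And>v. 0 \<le> quad_form (L X0) v"
  obtains r X where "r \<ge> 0" "X \<in> psd_mats" "X \<noteq> 0" "L X = r *\<^sub>R X"
proof -
  obtain K where K: "\<And>X. norm (L X) \<le> K * norm X"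
    using linear_bounded_pos[OF L] by blast
  obtain m where m: "\<And>u. m * quad_form (mat 1) u \<le> quad_form (- L (mat 1)) u"
    using generalized_Rayleigh_minimum[OF mat_1_pd] by metis
  \<comment> \<open>Exceeding \<open>K\<close> makes \<open>R\<close> injective; exceeding
    \<open>- m\<close>, an upper bound for the form of \<open>L (mat 1)\<close> on unit vectors,
    makes the inverse of \<open>R\<close> positive.\<close>
  define s where "s = max K (- m) + 1"
  define R where "R X = s *\<^sub>R X - L X" for X
  have R: "linear R"
    unfolding R_def[abs_def]
    by (intro linear_compose_sub L linear_compose_scale_right linear_id[unfolded id_def])
  have "X = 0" if "R X = 0" for X
  proof (rule ccontr)
    assume "X \<noteq> 0"
    have "L X = s *\<^sub>R X" using that by (simp add: R_def)
    then have "\<bar>s\<bar> * norm X \<le> K * norm X" using K[of X] by simp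
    with \<open>X \<noteq> 0\<close> show False by (simp add: s_def)
  qed
  then have "inj R" by (simp add: linear_injective_0[OF R])
  then obtain T where T: "linear T" and TR: "\<And>X. T (R X) = X" and RT: "\<And>X. R (T X) = X"
    using linear_injective_isomorphism[OF R] by blast
  \<comment> \<open>If the minimal Rayleigh value \<open>c\<close> of \<open>Y\<close> were
    negative, quasi-monotonicity at the null vector \<open>v\<close> of
    \<open>Y - c *\<^sub>R mat 1\<close> would give \<open>s \<le> - m\<close>.\<close>
  have Rpos: "0 \<le> quad_form Y u" if RY: "\<And>u. 0 \<le> quad_form (R Y) u" for Y u
  proof -
    obtain v c where v: "v \<noteq> 0" "quad_form Y v = c * quad_form (mat 1) v"
      and c: "\<And>u. c * quad_form (mat 1) u \<le> quad_form Y u"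
      using generalized_Rayleigh_minimum[OF mat_1_pd] by metis
    have "c \<ge> 0"
    proof (rule ccontr)
      assume "\<not> c \<ge> 0"
      then have "c < 0" by simp
      have "0 \<le> quad_form (L (Y - c *\<^sub>R mat 1)) v"
        by (rule qm) (use v c in auto)
      also have "\<dots> = s * (c * (v \<bullet> v)) - quad_form (R Y) v - c * quad_form (L (mat 1)) v"
        using v by (simp add: linear_diff[OF L] linear_cmul[OF L] R_def)
      also have "\<dots> \<le> c * (s * (v \<bullet> v) - quad_form (L (mat 1)) v)"
        using RY[of v] by (simp add: algebra_simps)
      finally have "s * (v \<bullet> v) \<le> quad_form (L (mat 1)) v"
        using \<open>c < 0\<close> by (simp add: zero_le_mult_iff)
      also have "\<dots> \<le> (- m) * (v \<bullet> v)" using m[of v] by simp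
      finally have "s \<le> - m"
        using v(1) mult_le_cancel_right_pos[of "v \<bullet> v" s "- m"] by simp
      then show False by (simp add: s_def)
    qed
    then have "0 \<le> c * quad_form (mat 1) u" by simp
    then show ?thesis using c[of u] by linarith
  qed
  have Tsym: "T X \<in> sym_mats" if "X \<in> sym_mats" for X
  proof -
    have "R (transpose (T X)) = transpose (R (T X))"
      by (simp add: R_def sym transpose_diff transpose_scalar)
    also have "\<dots> = R (T X)" using that by (simp add: RT sym_mats_def)
    finally show ?thesis using \<open>inj R\<close> by (simp add: sym_mats_def inj_eq)
  qed
  have Tpsd: "T X \<in> psd_mats" if "X \<in> psd_mats" for X
    using that Rpos[of "T X"] Tsym by (simp add: psd_mats_iff RT)
  have T0: "T X \<noteq> 0" if "X \<noteq> 0" for X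
    using that RT[of X] linear_0[OF R] by auto
  have LT: "L (T X) = T (L X)" for X
  proof -
    have "R (L (T X)) = L (R (T X))"
      by (simp add: R_def linear_diff[OF L] linear_cmul[OF L])
    then show ?thesis by (metis RT TR)
  qed
  \<comment> \<open>Fixing the trace cuts a compact convex base out of the cone of admissible
    \<open>X\<close>.\<close>
  define \<Delta> where "\<Delta> = {X \<in> psd_mats. X \<bullet> mat 1 = 1 \<and> (\<forall>v. 0 \<le> quad_form (L X) v)}"
  have \<Delta>eq: "\<Delta> = sym_mats \<inter> {X. X \<bullet> mat 1 = 1} \<inter> (\<Inter>v. {X. 0 \<le> quad_form X v})
      \<inter> (\<Inter>v. {X. 0 \<le> quad_form (L X) v})"
    by (auto simp: \<Delta>_def psd_mats_iff)
  have "closed \<Delta>"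
    unfolding \<Delta>eq using linear_continuous_on[OF linear_conv_bounded_linear[THEN iffD1, OF L]]
    by (intro closed_Int closed_sym_mats closed_INT ballI closed_Collect_eq closed_Collect_le
        continuous_on_quad_form continuous_on_const continuous_on_id continuous_on_inner) auto
  moreover have "bounded \<Delta>"
    unfolding bounded_iff using psd_norm_le by (fastforce simp: \<Delta>_def)
  ultimately have compact: "compact \<Delta>" by (simp add: compact_eq_bounded_closed)
  have convex: "convex \<Delta>"
    unfolding convex_def \<Delta>_def psd_mats_iff
    by (auto simp: sym_mats_add sym_mats_scaleR linear_add[OF L] linear_cmul[OF L]
        inner_add_left)
  have norm\<Delta>: "(1 / (Y \<bullet> mat 1)) *\<^sub>R Y \<in> \<Delta>"
    if "Y \<in> psd_mats" "Y \<noteq> 0" "\<And>v. 0 \<le> quad_form (L Y) v" for Y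
    using that psd_inner_mat_1_pos[of Y]
    by (auto simp: \<Delta>_def psd_mats_iff sym_mats_scaleR linear_cmul[OF L])
  have nz: "X \<noteq> 0" if "X \<in> \<Delta>" for X
    using that by (auto simp: \<Delta>_def)
  have tr: "0 < T X \<bullet> mat 1" if "X \<in> \<Delta>" for X
    using that nz[OF that] T0[of X] Tpsd[of X] psd_inner_mat_1_pos by (auto simp: \<Delta>_def)
  define F where "F X = (1 / (T X \<bullet> mat 1)) *\<^sub>R T X" for X
  have "continuous_on \<Delta> F"
    unfolding F_def
    using linear_continuous_on[OF linear_conv_bounded_linear[THEN iffD1, OF T]] tr
    by (intro continuous_on_scaleR continuous_on_divide continuous_on_const continuous_on_inner)
       force+
  moreover have "F \<in> \<Delta> \<rightarrow> \<Delta>"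
  proof
    fix X assume X: "X \<in> \<Delta>"
    have "0 \<le> quad_form (L (T X)) v" for v
      using X Rpos[of "T (L X)"] by (simp add: LT RT \<Delta>_def)
    then show "F X \<in> \<Delta>"
      unfolding F_def using X nz[OF X] T0 Tpsd by (intro norm\<Delta>) (auto simp: \<Delta>_def)
  qed
  moreover have "\<Delta> \<noteq> {}" using norm\<Delta>[OF X0] by blast
  ultimately obtain X where X: "X \<in> \<Delta>" "F X = X"
    using brouwer[OF compact convex] by blast
  define \<rho> where "\<rho> = T X \<bullet> mat 1"
  have \<rho>: "\<rho> > 0" using tr[OF X(1)] by (simp add: \<rho>_def)
  \<comment> \<open>A fixed point of \<open>F\<close> is an eigenvector of the resolvent; inverting
    \<rho> translates this into an eigenvalue of \<open>L\<close>.\<close>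
  have "\<rho> *\<^sub>R F X = T X" using \<rho> by (simp add: F_def flip: \<rho>_def)
  then have "T X = \<rho> *\<^sub>R X" using X(2) by simp
  then have "X = \<rho> *\<^sub>R R X" using RT[of X] linear_cmul[OF R] by metis
  then have "(1 / \<rho>) *\<^sub>R X = R X" using \<rho> by (metis divide_self_if less_irrefl scaleR_one scaleR_scaleR times_divide_eq_left mult_1)
  then have LX: "L X = (s - 1 / \<rho>) *\<^sub>R X" by (simp add: R_def algebra_simps)
  \<comment> \<open>As \<open>X\<close> has trace 1, the trace of \<open>L X\<close> is the
    eigenvalue itself.\<close>
  have "0 \<le> L X \<bullet> mat 1"
    unfolding inner_mat_1 using X(1) by (simp add: \<Delta>_def sum_nonneg)
  then have "0 \<le> s - 1 / \<rho>" using X(1) by (simp add: LX \<Delta>_def)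
  then show ?thesis using that[OF _ _ nz[OF X(1)] LX] X(1) by (simp add: \<Delta>_def)
qed

section \<open>Reduction of the matrix inequalities to a single Lyapunov inequality\<close>

lemma opC_adj_eq: "opC_adj N A \<mu> P = opC N (\<lambda>i. transpose (A i)) \<mu> P"
  by (simp add: opC_adj_def opC_def)

lemma opH_adj_eq: "opH_adj B i P = opH (\<lambda>i. transpose (B i)) i P"
  by (simp add: opH_adj_def opH_def)

lemma lmi_feasible_iff:
  fixes A B :: "nat \<Rightarrow> real^'n^'n"
  shows "lmi_feasible N A B \<mu> \<longleftrightarrow>
    (\<exists>P\<in>pd_mats. - opL N (\<lambda>i. transpose (A i)) (\<lambda>i. transpose (B i)) \<mu> P \<in> form_pos)"
    (is "?lhs \<longleftrightarrow> (\<exists>P\<in>pd_mats. - ?L P \<in> form_pos)")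
proof
  assume ?lhs
  then obtain P Q where P: "P \<in> pd_mats"
    and 1: "opC_adj N A \<mu> P + (\<Sum>i=1..N. Q i) \<prec>\<^sub>L 0"
    and 2: "\<And>i. i \<in> {1..N} \<Longrightarrow> opH_adj B i P - Q i \<preceq>\<^sub>L 0"
    unfolding lmi_feasible_def by blast
  have "0 < quad_form (- ?L P) v" if "v \<noteq> 0" for v
  proof -
    have "(\<Sum>i=1..N. quad_form (opH_adj B i P) v) \<le> (\<Sum>i=1..N. quad_form (Q i) v)"
      using 2 by (intro sum_mono) (auto simp: loewner_le_def psd_mats_iff)
    moreover have "quad_form (opC_adj N A \<mu> P) v + (\<Sum>i=1..N. quad_form (Q i) v) < 0"
      using 1 that by (auto simp: loewner_less_def pd_mats_iff quad_form_sum)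
    ultimately show ?thesis
      by (simp add: opL_def quad_form_sum flip: opC_adj_eq opH_adj_eq)
  qed
  with P show "\<exists>P\<in>pd_mats. - ?L P \<in> form_pos" by (auto simp: form_pos_def)
next
  assume "\<exists>P\<in>pd_mats. - ?L P \<in> form_pos"
  then obtain P where P: "P \<in> pd_mats" and LP: "- ?L P \<in> form_pos" by blast
  from LP obtain m where m: "m > 0" "\<And>v. m * (norm v)\<^sup>2 \<le> quad_form (- ?L P) v"
    by (rule form_pos_lower_bound) blast
  \<comment> \<open>With \<open>N + 1\<close> in the denominator the \<open>N\<close> added
    multiples of the identity stay strictly below the margin \<open>m\<close>.\<close>
  define \<delta> where "\<delta> = m / (N + 1)"
  have \<delta>: "\<delta> > 0" "N * \<delta> < m" using m(1) by (simp_all add: \<delta>_def field_simps)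
  define Q where "Q i = opH_adj B i P + \<delta> *\<^sub>R mat 1" for i
  have Psym: "P \<in> sym_mats" and Ppos: "0 \<le> quad_form P v" for v
    using P by (cases "v = 0"; auto simp: pd_mats_iff less_imp_le)+
  have Hsym: "opH_adj B i P \<in> sym_mats" for i
    by (simp add: opH_adj_eq opH_sym Psym)
  have "Q i \<in> sym_mats" for i
    by (simp add: Q_def sym_mats_add sym_mats_scaleR Hsym sym_mats_mat_1)
  then have "Q i \<in> pd_mats" for i
    using \<delta>(1) Ppos by (auto simp: Q_def pd_mats_iff opH_adj_eq quad_form_opH add_nonneg_pos)
  moreover have "opH_adj B i P - Q i \<preceq>\<^sub>L 0" for i
    using \<delta>(1) by (simp add: Q_def loewner_le_def psd_mats_iff sym_mats_scaleR sym_mats_mat_1)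
  moreover have "opC_adj N A \<mu> P + (\<Sum>i=1..N. Q i) \<prec>\<^sub>L 0"
  proof -
    have eq: "0 - (opC_adj N A \<mu> P + (\<Sum>i=1..N. Q i)) = - ?L P - (N * \<delta>) *\<^sub>R mat 1"
      by (simp add: Q_def opL_def opC_adj_eq opH_adj_eq sum.distrib sum_constant_scaleR
          del: sum_constant)
    have "0 < quad_form (- ?L P - (N * \<delta>) *\<^sub>R mat 1) v" if "v \<noteq> 0" for v
    proof -
      have "N * \<delta> * (norm v)\<^sup>2 < m * (norm v)\<^sup>2" using \<delta>(2) that by simp
      then show ?thesis using m(2)[of v] by (simp add: power2_norm_eq_inner)
    qed
    then show ?thesis
      unfolding loewner_less_def eq pd_mats_iff
      by (simp add: sym_mats_diff sym_mats_minus opL_sym Psym sym_mats_scaleR sym_mats_mat_1)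
  qed
  ultimately show ?lhs using P unfolding lmi_feasible_def by blast
qed

text \<open>Feasibility concerns the adjoint, so the alternative is applied with the adjoint as
  \<open>f\<close>; its witness then lives on the side of \<open>opL\<close>.\<close>

lemma opL_nonneg_eigenvector:
  fixes A B :: "nat \<Rightarrow> real^'n^'n"
  assumes "\<not> lmi_feasible N A B \<mu>"
  obtains r X where "r \<ge> 0" "X \<in> psd_mats" "X \<noteq> 0" "opL N A B \<mu> X = r *\<^sub>R X"
proof -
  let ?L = "opL N A B \<mu>" and ?M = "opL N (\<lambda>i. transpose (A i)) (\<lambda>i. transpose (B i)) \<mu>"
  have adj: "?M X \<bullet> Y = X \<bullet> ?L Y" for X Y
    using inner_opL[of N A B \<mu> Y X] by (simp add: inner_commute)
  obtain X0 where "X0 \<in> psd_mats" "X0 \<noteq> 0" "\<And>v. 0 \<le> quad_form (?L X0) v"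
    using Lyapunov_alternative[OF linear_opL adj] assms unfolding lmi_feasible_iff by blast
  from nonneg_eigenvector_psd[OF linear_opL opL_transpose opL_quasi_monotone this] that
  show ?thesis by blast
qed

text \<open>Otherwise the alternative yields a nonzero semidefinite \<open>X\<close> with
  \<open>?M X\<close> nonnegative. Scale \<open>P\<close> until it just dominates \<open>X\<close>;
  at the contact vector quasi-monotonicity contradicts the negativity of
  \<open>?M P\<close>.\<close>

lemma lmi_feasible_imp_primal:
  fixes A B :: "nat \<Rightarrow> real^'n^'n"
  assumes "lmi_feasible N A B \<mu>"
  obtains Z where "Z \<in> pd_mats" "- opL N A B \<mu> Z \<in> form_pos"
proof (rule ccontr)
  let ?M = "opL N (\<lambda>i. transpose (A i)) (\<lambda>i. transpose (B i)) \<mu>"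
  assume "\<not> thesis"
  with that have none: "- opL N A B \<mu> Z \<notin> form_pos" if "Z \<in> pd_mats" for Z
    using that by blast
  obtain X where X: "X \<in> psd_mats" "X \<noteq> 0" "\<And>v. 0 \<le> quad_form (?M X) v"
    using Lyapunov_alternative[OF linear_opL inner_opL none] by blast
  from assms obtain P where P: "P \<in> pd_mats" "- ?M P \<in> form_pos"
    unfolding lmi_feasible_iff by blast
  \<comment> \<open>\<open>- m\<close> is the least factor for which the multiple of
    \<open>P\<close> dominates \<open>X\<close>, with contact at \<open>v\<close>.\<close>
  obtain v m where v: "v \<noteq> 0" "quad_form (- X) v = m * quad_form P v"
    and m: "\<And>u. m * quad_form P u \<le> quad_form (- X) u"
    using generalized_Rayleigh_minimum[OF P(1)] by metis
  have "m < 0"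
  proof (rule ccontr)
    assume "\<not> m < 0"
    have "quad_form X u = 0" for u
    proof (rule antisym)
      have "0 \<le> quad_form P u" using P(1) by (cases "u = 0") (auto simp: pd_mats_iff less_imp_le)
      with \<open>\<not> m < 0\<close> have "0 \<le> m * quad_form P u" by simp
      with m[of u] show "quad_form X u \<le> 0" by simp
      show "0 \<le> quad_form X u" using X(1) by (simp add: psd_mats_iff)
    qed
    then have "X \<bullet> mat 1 = 0" by (simp add: inner_mat_1)
    with psd_inner_mat_1_pos[OF X(1,2)] show False by simp
  qed
  have "0 \<le> quad_form (?M ((- m) *\<^sub>R P - X)) v"
  proof (rule opL_quasi_monotone)
    show "0 \<le> quad_form ((- m) *\<^sub>R P - X) u" for u using m[of u] by simp
  qed (use v in simp)
  also have "\<dots> = (- m) * quad_form (?M P) v - quad_form (?M X) v"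
    by (simp add: linear_diff[OF linear_opL] linear_cmul[OF linear_opL] linear_neg[OF linear_opL])
  also have "\<dots> < 0"
  proof -
    have "quad_form (?M P) v < 0" using P(2) v(1) by (auto simp: form_pos_def)
    then have "(- m) * quad_form (?M P) v < 0" using \<open>m < 0\<close> by (simp add: mult_neg_neg)
    then show ?thesis using X(3)[of v] by simp
  qed
  finally show False by simp
qed

subsection \<open>First-exit arguments\<close>

text \<open>The times at which \<open>D\<close> is outside \<open>U\<close> form a closed set
  bounded below, so their infimum is itself such a time.\<close>

lemma first_exit:
  fixes D :: "real \<Rightarrow> 'a::topological_space"
  assumes "open U" "continuous_on {0..} D" "D 0 \<in> U" "t \<ge> 0" "D t \<notin> U"
  obtains t0 where "t0 > 0" "D t0 \<notin> U" "\<And>s. 0 \<le> s \<Longrightarrow> s < t0 \<Longrightarrow> D s \<in> U"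
proof -
  define S where "S = D -` (- U) \<inter> {0..}"
  have "closed S"
    unfolding S_def using assms(1,2) by (metis closed_Compl closed_atLeast continuous_on_closed_vimage)
  moreover have "t \<in> S" using assms by (simp add: S_def)
  moreover have bdd: "bdd_below S" by (auto simp: S_def)
  ultimately have Inf: "Inf S \<in> S" using closed_contains_Inf by blast
  then have "Inf S \<noteq> 0" "Inf S \<ge> 0" using assms(3) by (auto simp: S_def)
  moreover have "D s \<in> U" if "0 \<le> s" "s < Inf S" for s
    using cInf_lower[OF _ bdd, of s] that by (force simp: S_def)
  ultimately show ?thesis using that[of "Inf S"] Inf by (auto simp: S_def)
qed

lemma nonneg_at_right_end:
  fixes f :: "real \<Rightarrow> real"
  assumes "continuous_on {0..} f" "t > 0" "\<And>s. 0 \<le> s \<Longrightarrow> s < t \<Longrightarrow> 0 \<le> f s"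
  shows "0 \<le> f t"
proof -
  have cl: "closure {0..<t} = {0..t}" using assms(2) by simp
  have "continuous_on (closure {0..<t}) f"
    unfolding cl using assms(1) by (rule continuous_on_subset) auto
  moreover have "t \<in> closure {0..<t}" unfolding cl using assms(2) by simp
  ultimately show ?thesis
    by (rule continuous_ge_on_closure) (use assms(3) in auto)
qed

lemma derivative_nonpos_at_first_exit:
  fixes f :: "real \<Rightarrow> real"
  assumes "(f has_real_derivative d) (at t within {0..})" "t > 0" "f t \<le> 0"
    and "\<And>s. 0 \<le> s \<Longrightarrow> s < t \<Longrightarrow> 0 < f s"
  shows "d \<le> 0"
proof (rule ccontr)
  assume "\<not> d \<le> 0"
  then obtain e where e: "e > 0" "\<And>h. h > 0 \<Longrightarrow> t - h \<in> {0..} \<Longrightarrow> h < e \<Longrightarrow> f (t - h) < f t"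
    using has_real_derivative_pos_inc_left[OF assms(1)] by auto
  define h where "h = min (e / 2) t"
  have "h > 0" "h < e" "t - h \<ge> 0" "t - h < t"
    using e(1) assms(2) by (auto simp: h_def min_def)
  then show False using e(2)[of h] assms(3) assms(4)[of "t - h"] by simp
qed

text \<open>At the first exit time some nonzero \<open>v\<close> annihilates the form, which was
  positive along \<open>v\<close> before, so its derivative there is at most 0, against
  \<open>inward\<close>. That hypothesis may assume nonnegativity on the whole past because delayed
  values enter the derivative.\<close>

lemma form_pos_invariant:
  fixes D :: "real \<Rightarrow> real^'n^'n"
  assumes deriv: "\<And>t. t \<ge> 0 \<Longrightarrow> (D has_vector_derivative D' t) (at t within {0..})"
    and D0: "D 0 \<in> form_pos"
    and inward: "\<And>t v. t > 0 \<Longrightarrow> v \<noteq> 0 \<Longrightarrow> (\<And>s u. 0 \<le> s \<Longrightarrow> s \<le> t \<Longrightarrow> 0 \<le> quad_form (D s) u) \<Longrightarrow>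
      quad_form (D t) v = 0 \<Longrightarrow> 0 < quad_form (D' t) v"
    and "t \<ge> 0"
  shows "D t \<in> form_pos"
proof (rule ccontr)
  assume "D t \<notin> form_pos"
  have cont: "continuous_on {0..} D"
    unfolding continuous_on_eq_continuous_within
    by (intro ballI has_vector_derivative_continuous[OF deriv]) simp
  obtain t0 where t0: "t0 > 0" "D t0 \<notin> form_pos" "\<And>s. 0 \<le> s \<Longrightarrow> s < t0 \<Longrightarrow> D s \<in> form_pos"
    using first_exit[OF open_form_pos cont D0 \<open>t \<ge> 0\<close> \<open>D t \<notin> form_pos\<close>] by metis
  have nonneg: "0 \<le> quad_form (D s) u" if "0 \<le> s" "s < t0" for s u
    using t0(3)[OF that] by (cases "u = 0") (auto simp: form_pos_def less_imp_le)
  have "0 \<le> quad_form (D t0) u" for u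
    by (rule nonneg_at_right_end[OF _ t0(1)])
       (auto intro!: continuous_on_quad_form cont nonneg)
  with nonneg have nonneg': "0 \<le> quad_form (D s) u" if "0 \<le> s" "s \<le> t0" for s u
    using that by (cases "s = t0") auto
  from t0(2) obtain v where v: "v \<noteq> 0" "quad_form (D t0) v \<le> 0"
    by (auto simp: form_pos_def not_less)
  have "((\<lambda>s. quad_form (D s) v) has_real_derivative quad_form (D' t0) v) (at t0 within {0..})"
    using bounded_linear.has_vector_derivative[OF bounded_linear_quad_form deriv[of t0]] t0(1)
    by (simp add: has_real_derivative_iff_has_vector_derivative)
  then have "quad_form (D' t0) v \<le> 0"
    by (rule derivative_nonpos_at_first_exit) (use t0 v in \<open>auto simp: form_pos_def\<close>)
  moreover have "0 < quad_form (D' t0) v"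
    using inward[OF t0(1) v(1) nonneg'] nonneg'[of t0 v] v(2) t0(1) by force
  ultimately show False by simp
qed

text \<open>Uniqueness for zero history, by comparison with a barrier that grows exponentially
  faster than the equation permits. It serves to show that solutions stay symmetric.\<close>

lemma linear_delay_equation_zero:
  fixes K :: "real \<Rightarrow> 'a::euclidean_space"
  assumes f: "linear f" and g: "\<And>i. i \<in> I \<Longrightarrow> linear (g i)" and I: "finite I"
    and h: "\<And>i. i \<in> I \<Longrightarrow> 0 \<le> h i \<and> h i \<le> \<tau>"
    and "\<tau> \<ge> 0" and init: "\<And>s. - \<tau> \<le> s \<Longrightarrow> s \<le> 0 \<Longrightarrow> K s = 0"
    and deriv: "\<And>t. t \<ge> 0 \<Longrightarrow>
      (K has_vector_derivative f (K t) + (\<Sum>i\<in>I. g i (K (t - h i)))) (at t within {0..})"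
    and "t \<ge> 0"
  shows "K t = 0"
proof (rule ccontr)
  assume Kt: "K t \<noteq> 0"
  obtain M where M: "M > 0" "\<And>x. norm (f x) \<le> M * norm x"
    using linear_bounded_pos[OF f] by blast
  have "\<forall>i\<in>I. \<exists>m>0. \<forall>x. norm (g i x) \<le> m * norm x"
    using g linear_bounded_pos by metis
  then obtain m where m: "\<And>i. i \<in> I \<Longrightarrow> m i > 0" "\<And>i x. i \<in> I \<Longrightarrow> norm (g i x) \<le> m i * norm x"
    by metis
  define c where "c = M + sum m I"
  \<comment> \<open>The extra 1 leaves the surplus \<open>2 * E\<^sup>2\<close> in the derivative of
    \<phi> at the exit time.\<close>
  define k where "k = c + 1"
  have "c > 0" using M(1) m(1) by (simp add: c_def add_pos_nonneg sum_nonneg less_imp_le)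
  then have "k > 0" by (simp add: k_def)
  \<comment> \<open>The barrier passes through \<open>norm (K t)\<close> at time \<open>t\<close>,
    so an exit of \<phi> from the positive reals is certain.\<close>
  define \<epsilon> where "\<epsilon> = norm (K t) / exp (k * t)"
  have "\<epsilon> > 0" using Kt by (simp add: \<epsilon>_def)
  \<comment> \<open>Squares are compared because the norm itself need not be differentiable.\<close>
  define \<phi> where "\<phi> s = (\<epsilon> * exp (k * s))\<^sup>2 - (norm (K s))\<^sup>2" for s
  have \<phi>_pos: "norm (K s) < \<epsilon> * exp (k * s)" if "\<phi> s > 0" for s
    using that \<open>\<epsilon> > 0\<close> by (auto simp: \<phi>_def intro: power2_less_imp_less)
  have cont: "continuous_on {0..} K"
    unfolding continuous_on_eq_continuous_within
    by (intro ballI has_vector_derivative_continuous[OF deriv]) simp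
  have cont\<phi>: "continuous_on {0..} \<phi>"
    unfolding \<phi>_def by (intro continuous_intros cont)
  have "\<phi> 0 \<in> {0<..}" using init[of 0] \<open>\<tau> \<ge> 0\<close> \<open>\<epsilon> > 0\<close> by (simp add: \<phi>_def)
  moreover have "\<phi> t \<notin> {0<..}" by (simp add: \<phi>_def \<epsilon>_def)
  ultimately obtain t0 where t0: "t0 > 0" "\<phi> t0 \<notin> {0<..}"
    and before: "\<And>s. 0 \<le> s \<Longrightarrow> s < t0 \<Longrightarrow> \<phi> s \<in> {0<..}"
    using first_exit[OF _ cont\<phi> _ \<open>t \<ge> 0\<close>, of "{0<..}"] by (metis open_greaterThan)
  define E where "E = \<epsilon> * exp (k * t0)"
  have "E > 0" using \<open>\<epsilon> > 0\<close> by (simp add: E_def)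
  have "0 \<le> \<phi> t0"
    by (rule nonneg_at_right_end[OF cont\<phi> t0(1)]) (use before in \<open>auto simp: less_imp_le\<close>)
  with t0(2) have "\<phi> t0 = 0" by simp
  then have Kt0: "norm (K t0) = E"
    using \<open>E > 0\<close> by (simp add: \<phi>_def E_def power2_eq_iff_nonneg)
  \<comment> \<open>The barrier is increasing and the history is zero, so its value at
    \<open>t0\<close> bounds all delayed terms too.\<close>
  have Ks: "norm (K s) \<le> E" if s: "- \<tau> \<le> s" "s \<le> t0" for s
  proof -
    consider "s \<le> 0" | "0 \<le> s" "s < t0" | "s = t0" using s(2) by force
    then show ?thesis
    proof cases
      case 1
      then show ?thesis using init[of s] s(1) \<open>E > 0\<close> by simp
    next
      case 2
      then have "norm (K s) < \<epsilon> * exp (k * s)" using before[of s] \<phi>_pos by simp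
      also have "\<dots> \<le> E" using s(2) \<open>k > 0\<close> \<open>\<epsilon> > 0\<close> by (simp add: E_def)
      finally show ?thesis by simp
    qed (simp add: Kt0)
  qed
  define K' where "K' = f (K t0) + (\<Sum>i\<in>I. g i (K (t0 - h i)))"
  have "norm K' \<le> M * E + (\<Sum>i\<in>I. m i * E)"
    unfolding K'_def
  proof (intro order_trans[OF norm_triangle_ineq] add_mono order_trans[OF norm_sum] sum_mono)
    show "norm (f (K t0)) \<le> M * E" using M(2)[of "K t0"] Kt0 by simp
    show "norm (g i (K (t0 - h i))) \<le> m i * E" if "i \<in> I" for i
    proof -
      have "norm (K (t0 - h i)) \<le> E" using h[OF that] t0(1) by (intro Ks) auto
      then show ?thesis
        using m(1,2)[OF that] by (meson less_imp_le mult_left_mono order_trans)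
    qed
  qed
  then have "norm K' \<le> c * E" by (simp add: c_def sum_distrib_right distrib_right)
  then have "E * norm K' \<le> E * (c * E)" using \<open>E > 0\<close> by simp
  then have "K t0 \<bullet> K' \<le> c * E\<^sup>2"
    using norm_cauchy_schwarz[of "K t0" K'] by (simp add: Kt0 power2_eq_square mult_ac)
  have \<phi>_eq: "\<phi> = (\<lambda>s. (\<epsilon> * exp (k * s))\<^sup>2 - K s \<bullet> K s)"
    by (simp add: \<phi>_def power2_norm_eq_inner fun_eq_iff)
  have K_deriv: "(K has_derivative (\<lambda>x. x *\<^sub>R K')) (at t0 within {0..})"
    using deriv[of t0] t0(1) by (simp add: K'_def has_vector_derivative_def)
  have "((\<lambda>s. K s \<bullet> K s) has_real_derivative 2 * (K t0 \<bullet> K')) (at t0 within {0..})"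
    unfolding has_field_derivative_def
    by (rule has_derivative_eq_rhs[OF has_derivative_inner[OF K_deriv K_deriv]])
       (auto simp: fun_eq_iff inner_commute)
  moreover have "((\<lambda>s. (\<epsilon> * exp (k * s))\<^sup>2) has_real_derivative 2 * k * E\<^sup>2) (at t0 within {0..})"
    by (auto intro!: derivative_eq_intros simp: E_def power2_eq_square algebra_simps)
  ultimately have "(\<phi> has_real_derivative (2 * k * E\<^sup>2 - 2 * (K t0 \<bullet> K'))) (at t0 within {0..})"
    unfolding \<phi>_eq by (intro DERIV_diff)
  then have "2 * k * E\<^sup>2 - 2 * (K t0 \<bullet> K') \<le> 0"
    by (rule derivative_nonpos_at_first_exit) (use t0 before in auto)
  moreover have "2 * k * E\<^sup>2 = 2 * (c * E\<^sup>2) + 2 * E\<^sup>2" by (simp add: k_def algebra_simps)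
  ultimately have "E\<^sup>2 \<le> 0" using \<open>K t0 \<bullet> K' \<le> c * E\<^sup>2\<close> by linarith
  with \<open>E > 0\<close> show False by simp
qed

subsection \<open>Decay of solutions\<close>

lemma bounded_linear_transpose: "bounded_linear (transpose :: real^'n^'n \<Rightarrow> real^'n^'n)"
  by (intro linear_conv_bounded_linear[THEN iffD1] linearI) (simp_all add: transpose_add transpose_scalar)

lemma max_delay_ge: "i \<in> {1..N} \<Longrightarrow> h i \<le> max_delay N h"
  unfolding max_delay_def by (intro Max_ge) auto

lemma max_delay_nonneg:
  assumes "N \<ge> 1" "\<forall>i\<in>{1..N}. 0 \<le> h i"
  shows "0 \<le> max_delay N h"
proof -
  have 1: "1 \<in> {1..N}" using assms(1) by simp
  show ?thesis by (rule order_trans[OF bspec[OF assms(2) 1] max_delay_ge[OF 1, of h]])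
qed

text \<open>The antisymmetric difference solves the same linear delay equation with zero
  history.\<close>

lemma is_solution_sym:
  fixes A B :: "nat \<Rightarrow> real^'n^'n"
  assumes N: "N \<ge> 1" and h: "\<forall>i\<in>{1..N}. 0 \<le> h i"
    and sol: "is_solution N A B \<mu> h \<Xi> X"
    and sym: "\<Xi> ` {-max_delay N h..0} \<subseteq> sym_mats" and "t \<ge> 0"
  shows "X t \<in> sym_mats"
proof -
  have "X t - transpose (X t) = 0"
  proof (rule linear_delay_equation_zero[where f = "opC N A \<mu>" and g = "opH B" and I = "{1..N}"
        and h = h and \<tau> = "max_delay N h"])
    fix s assume "- max_delay N h \<le> s" "s \<le> 0"
    then show "X s - transpose (X s) = 0"
      using sol sym by (force simp: is_solution_def sym_mats_def)
  next
    fix t :: real assume "t \<ge> 0"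
    then have d: "(X has_vector_derivative
        (opC N A \<mu> (X t) + (\<Sum>i=1..N. opH B i (X (t - h i))))) (at t within {0..})"
      using sol by (simp add: is_solution_def)
    from has_vector_derivative_diff[OF d bounded_linear.has_vector_derivative[OF bounded_linear_transpose d]]
    show "((\<lambda>t. X t - transpose (X t)) has_vector_derivative
        opC N A \<mu> (X t - transpose (X t)) +
        (\<Sum>i=1..N. opH B i (X (t - h i) - transpose (X (t - h i))))) (at t within {0..})"
      by (simp add: linear_diff[OF linear_opC] linear_diff[OF linear_opH] opC_transpose
          opH_transpose transpose_add transpose_sum sum_subtractf algebra_simps)
  qed (use linear_opC linear_opH h max_delay_ge max_delay_nonneg[OF N h] \<open>t \<ge> 0\<close> in auto)
  then show ?thesis by (simp add: sym_mats_def)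
qed

text \<open>The matrix is the residual of \<open>exp (- \<alpha> * t) *\<^sub>R Z\<close> in the
  delay equation, up to the scalar exponential. It is continuous in \<alpha> and lies in the open
  set \<open>form_pos\<close> at 0; the rate obtained depends on the delays.\<close>

lemma decay_rate_exists:
  fixes A B :: "nat \<Rightarrow> real^'n^'n"
  assumes "- opL N A B \<mu> Z \<in> form_pos"
  obtains \<alpha> where "\<alpha> > 0"
    "- (opC N A \<mu> Z + \<alpha> *\<^sub>R Z + (\<Sum>i=1..N. exp (\<alpha> * h i) *\<^sub>R opH B i Z)) \<in> form_pos"
proof -
  define G where "G \<alpha> = - (opC N A \<mu> Z + \<alpha> *\<^sub>R Z + (\<Sum>i=1..N. exp (\<alpha> * h i) *\<^sub>R opH B i Z))" for \<alpha>
  have "isCont G 0" unfolding G_def by (intro continuous_intros)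
  then have "(G \<longlongrightarrow> G 0) (at_right 0)"
    by (simp add: isCont_def filterlim_at_split)
  moreover have "G 0 \<in> form_pos" using assms by (simp add: G_def opL_def)
  ultimately have "eventually (\<lambda>\<alpha>. G \<alpha> \<in> form_pos) (at_right 0)"
    by (intro topological_tendstoD[OF _ open_form_pos])
  then obtain b where "b > 0" "\<And>\<alpha>. \<alpha> > 0 \<Longrightarrow> \<alpha> < b \<Longrightarrow> G \<alpha> \<in> form_pos"
    by (auto simp: eventually_at_right_field)
  then have "b / 2 > 0" "G (b / 2) \<in> form_pos" by auto
  then show ?thesis unfolding G_def by (rule that)
qed

text \<open>The combined curve solves the delay equation with an added positive definite source. At
  a null vector the undelayed part is nonnegative by quasi-monotonicity, the delayed part by
  positivity on the past, and the source is strictly positive.\<close>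

lemma comparison_bound:
  fixes A B :: "nat \<Rightarrow> real^'n^'n"
  assumes N: "N \<ge> 1" and h: "\<forall>i\<in>{1..N}. 0 \<le> h i"
    and G: "- (opC N A \<mu> Z + \<alpha> *\<^sub>R Z + (\<Sum>i=1..N. exp (\<alpha> * h i) *\<^sub>R opH B i Z)) \<in> form_pos"
      (is "?G \<in> _")
    and "c > 0"
    and sol: "is_solution N A B \<mu> h \<Xi> X"
    and init: "\<And>s. - max_delay N h \<le> s \<Longrightarrow> s \<le> 0 \<Longrightarrow>
      (c * exp (- \<alpha> * s)) *\<^sub>R Z + \<sigma> *\<^sub>R \<Xi> s \<in> form_pos"
    and "t \<ge> 0"
  shows "(c * exp (- \<alpha> * t)) *\<^sub>R Z + \<sigma> *\<^sub>R X t \<in> form_pos"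
proof (rule form_pos_invariant[OF _ _ _ \<open>t \<ge> 0\<close>])
  define D where "D t = (c * exp (- \<alpha> * t)) *\<^sub>R Z + \<sigma> *\<^sub>R X t" for t
  define D' where "D' t = (- \<alpha> * c * exp (- \<alpha> * t)) *\<^sub>R Z
    + \<sigma> *\<^sub>R (opC N A \<mu> (X t) + (\<Sum>i=1..N. opH B i (X (t - h i))))" for t
  show "((\<lambda>t. (c * exp (- \<alpha> * t)) *\<^sub>R Z + \<sigma> *\<^sub>R X t) has_vector_derivative D' t) (at t within {0..})"
    if "t \<ge> 0" for t
  proof -
    have "(X has_vector_derivative
        (opC N A \<mu> (X t) + (\<Sum>i=1..N. opH B i (X (t - h i))))) (at t within {0..})"
      using sol that by (simp add: is_solution_def)
    then show ?thesis
      unfolding D'_def by (auto intro!: derivative_eq_intros)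
  qed
  have DI: "D s \<in> form_pos" if "- max_delay N h \<le> s" "s \<le> 0" for s
    using init[OF that] that sol by (simp add: D_def is_solution_def)
  show "(c * exp (- \<alpha> * 0)) *\<^sub>R Z + \<sigma> *\<^sub>R X 0 \<in> form_pos"
    using DI[of 0] max_delay_nonneg[OF N h] by (simp add: D_def)
  fix t v
  assume t: "t > (0::real)" and v: "v \<noteq> (0 :: real^'n)"
    and nonneg: "\<And>s u. 0 \<le> s \<Longrightarrow> s \<le> t \<Longrightarrow>
      0 \<le> quad_form ((c * exp (- \<alpha> * s)) *\<^sub>R Z + \<sigma> *\<^sub>R X s) u"
    and zero: "quad_form ((c * exp (- \<alpha> * t)) *\<^sub>R Z + \<sigma> *\<^sub>R X t) v = 0"
  have D_nonneg: "0 \<le> quad_form (D s) u" if "- max_delay N h \<le> s" "s \<le> t" for s u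
  proof (cases "s \<le> 0")
    case True
    then show ?thesis using DI[of s] that by (cases "u = 0") (auto simp: form_pos_def less_imp_le)
  next
    case False
    then show ?thesis using nonneg[of s u] that by (simp add: D_def)
  qed
  \<comment> \<open>The factors \<open>exp (\<alpha> * h i)\<close> in \<open>?G\<close> come from
    evaluating the exponential at \<open>t - h i\<close>.\<close>
  have "D' t = opC N A \<mu> (D t) + (\<Sum>i=1..N. opH B i (D (t - h i))) + (c * exp (- \<alpha> * t)) *\<^sub>R ?G"
  proof -
    have "opH B i (D (t - h i)) = (c * exp (- \<alpha> * t)) *\<^sub>R (exp (\<alpha> * h i) *\<^sub>R opH B i Z)
        + \<sigma> *\<^sub>R opH B i (X (t - h i))" for i
      by (simp add: D_def linear_add[OF linear_opH] linear_cmul[OF linear_opH] algebra_simps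
          flip: exp_add)
    moreover have "opC N A \<mu> (D t) = (c * exp (- \<alpha> * t)) *\<^sub>R opC N A \<mu> Z + \<sigma> *\<^sub>R opC N A \<mu> (X t)"
      by (simp add: D_def linear_add[OF linear_opC] linear_cmul[OF linear_opC])
    ultimately show ?thesis
      by (simp add: D'_def sum.distrib scaleR_sum_right algebra_simps)
  qed
  moreover have "0 \<le> quad_form (opC N A \<mu> (D t)) v"
  proof (rule opC_quasi_monotone)
    show "0 \<le> quad_form (D t) u" for u
      using D_nonneg[of t u] t max_delay_nonneg[OF N h] by simp
    show "quad_form (D t) v = 0" using zero by (simp add: D_def)
  qed
  moreover have "0 \<le> quad_form (\<Sum>i=1..N. opH B i (D (t - h i))) v"
    unfolding quad_form_sum quad_form_opH
  proof (rule sum_nonneg)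
    fix i assume i: "i \<in> {1..N}"
    show "0 \<le> quad_form (D (t - h i)) (transpose (B i) *v v)"
      using max_delay_ge[OF i, of h] bspec[OF h i] t by (intro D_nonneg) auto
  qed
  moreover have "0 < quad_form ((c * exp (- \<alpha> * t)) *\<^sub>R ?G) v"
    using G v \<open>c > 0\<close> unfolding quad_form_scaleR form_pos_def by (intro mult_pos_pos) auto
  ultimately show "0 < quad_form (D' t) v" by simp
qed

text \<open>Histories are only required to be symmetric, since real and imaginary parts of complex
  eigenvectors need not be semidefinite.\<close>

lemma symmetric_exponential_decay:
  fixes A B :: "nat \<Rightarrow> real^'n^'n"
  assumes N: "N \<ge> 1" and lmi: "lmi_feasible N A B \<mu>" and h: "\<forall>i\<in>{1..N}. 0 \<le> h i"
  obtains \<alpha> \<beta> where "\<alpha> > 0" "\<beta> \<ge> 1"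
    "\<And>\<Xi> X t. continuous_on {-max_delay N h..0} \<Xi> \<Longrightarrow> \<Xi> ` {-max_delay N h..0} \<subseteq> sym_mats \<Longrightarrow>
       is_solution N A B \<mu> h \<Xi> X \<Longrightarrow> t \<ge> 0 \<Longrightarrow>
       norm (X t) \<le> \<beta> * exp (- \<alpha> * t) * (SUP s\<in>{-max_delay N h..0}. norm (\<Xi> s))"
proof -
  obtain Z where Z: "Z \<in> pd_mats" and LZ: "- opL N A B \<mu> Z \<in> form_pos"
    using lmi_feasible_imp_primal[OF lmi] by blast
  obtain \<alpha> where \<alpha>: "\<alpha> > 0"
    and G: "- (opC N A \<mu> Z + \<alpha> *\<^sub>R Z + (\<Sum>i=1..N. exp (\<alpha> * h i) *\<^sub>R opH B i Z)) \<in> form_pos"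
    using decay_rate_exists[OF LZ, of h] by blast
  obtain m where m: "m > 0" "\<And>v. m * (norm v)\<^sup>2 \<le> quad_form Z v"
    using form_pos_lower_bound[of Z] Z by (auto simp: pd_mats_eq)
  \<comment> \<open>The trace bound contributes the dimension and the trace of \<open>Z\<close>; the
    division by \<open>m\<close> comes from the constant \<open>c\<close> below.\<close>
  define \<kappa> where "\<kappa> = (CARD('n))\<^sup>2 * (Z \<bullet> mat 1) / m"
  have Z_nonneg: "0 \<le> quad_form Z v" for v
    using Z by (cases "v = 0") (auto simp: pd_mats_iff less_imp_le)
  then have "0 \<le> Z \<bullet> mat 1" unfolding inner_mat_1 by (intro sum_nonneg)
  then have \<kappa>: "\<kappa> \<ge> 0" using m(1) by (simp add: \<kappa>_def)
  let ?I = "{-max_delay N h..0}"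
  have bound: "norm (X t) \<le> \<kappa> * exp (- \<alpha> * t) * (SUP s\<in>?I. norm (\<Xi> s))"
    if \<Xi>: "continuous_on ?I \<Xi>" "\<Xi> ` ?I \<subseteq> sym_mats" and sol: "is_solution N A B \<mu> h \<Xi> X"
      and "t \<ge> 0" for \<Xi> X t
  proof -
    define S where "S = (SUP s\<in>?I. norm (\<Xi> s))"
    have "bdd_above ((\<lambda>s. norm (\<Xi> s)) ` ?I)"
      by (intro bounded_imp_bdd_above compact_imp_bounded compact_continuous_image
          continuous_on_norm \<Xi>(1) compact_Icc)
    then have S: "norm (\<Xi> s) \<le> S" if "s \<in> ?I" for s
      unfolding S_def using that by (rule cSUP_upper[rotated])
    have "S \<ge> 0" using max_delay_nonneg[OF N h] by (intro order_trans[OF norm_ge_zero S[of 0]]) simp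
    \<comment> \<open>The slack \<open>e\<close> makes the comparison strict at the start, also when
      the history is zero; it tends to 0 afterwards.\<close>
    have "norm (X t) \<le> \<kappa> * exp (- \<alpha> * t) * (S + e)" if "e > 0" for e
    proof -
      \<comment> \<open>Then \<open>c * m = S + e\<close>, so \<open>c *\<^sub>R Z\<close> strictly
        dominates plus and minus the history.\<close>
      define c where "c = (S + e) / m"
      have "c > 0" using \<open>S \<ge> 0\<close> that m(1) by (simp add: c_def)
      have cmp: "(c * exp (- \<alpha> * t)) *\<^sub>R Z + \<sigma> *\<^sub>R X t \<in> form_pos" if "\<bar>\<sigma>\<bar> = 1" for \<sigma>
      proof (rule comparison_bound[OF N h G \<open>c > 0\<close> sol _ \<open>t \<ge> 0\<close>])
        fix s assume s: "- max_delay N h \<le> s" "s \<le> 0"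
        show "(c * exp (- \<alpha> * s)) *\<^sub>R Z + \<sigma> *\<^sub>R \<Xi> s \<in> form_pos"
          unfolding form_pos_def
        proof (intro CollectI allI impI)
          fix v :: "real^'n" assume "v \<noteq> 0"
          have "\<bar>quad_form (\<sigma> *\<^sub>R \<Xi> s) v\<bar> \<le> norm (\<Xi> s) * (norm v)\<^sup>2"
            using abs_quad_form_le[of "\<sigma> *\<^sub>R \<Xi> s" v] \<open>\<bar>\<sigma>\<bar> = 1\<close> by simp
          also have "\<dots> \<le> S * (norm v)\<^sup>2"
            using S[of s] s by (intro mult_right_mono) auto
          also have "\<dots> < (S + e) * (norm v)\<^sup>2"
            using \<open>e > 0\<close> \<open>v \<noteq> 0\<close> by simp
          also have "\<dots> = c * (m * (norm v)\<^sup>2)" using m(1) by (simp add: c_def)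
          also have "\<dots> \<le> c * quad_form Z v" using m(2) \<open>c > 0\<close> by simp
          also have "\<dots> \<le> (c * quad_form Z v) * exp (- \<alpha> * s)"
          proof -
            have "0 \<le> c * quad_form Z v"
              using Z_nonneg \<open>c > 0\<close> by simp
            moreover have "1 \<le> exp (- \<alpha> * s)" using \<alpha> s by (simp add: mult_nonneg_nonpos)
            ultimately show ?thesis by (simp add: mult_le_cancel_left1)
          qed
          finally show "0 < quad_form ((c * exp (- \<alpha> * s)) *\<^sub>R Z + \<sigma> *\<^sub>R \<Xi> s) v"
            by (simp add: mult_ac)
        qed
      qed
      \<comment> \<open>The signs 1 and -1 of \<sigma> together enclose the form of
        \<open>X t\<close> from both sides.\<close>
      have le: "\<bar>quad_form (X t) v\<bar> \<le> quad_form ((c * exp (- \<alpha> * t)) *\<^sub>R Z) v" for v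
        using cmp[of 1] cmp[of "-1"] by (cases "v = 0") (force simp: form_pos_def)+
      have "X t \<in> sym_mats" using is_solution_sym[OF N h sol \<Xi>(2) \<open>t \<ge> 0\<close>] .
      from norm_le_inner_mat_1[OF this le]
      show ?thesis by (simp add: \<kappa>_def c_def mult_ac)
    qed
    then have *: "norm (X t) \<le> \<kappa> * exp (- \<alpha> * t) * S + \<kappa> * exp (- \<alpha> * t) * e" if "e > 0" for e
      using that by (simp add: distrib_left)
    have "((\<lambda>e. \<kappa> * exp (- \<alpha> * t) * S + \<kappa> * exp (- \<alpha> * t) * e) \<longlongrightarrow>
        \<kappa> * exp (- \<alpha> * t) * S + \<kappa> * exp (- \<alpha> * t) * 0) (at_right 0)"
      by (intro tendsto_intros)
    then have "norm (X t) \<le> \<kappa> * exp (- \<alpha> * t) * S + \<kappa> * exp (- \<alpha> * t) * 0"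
      by (rule tendsto_lowerbound) (use * in \<open>auto simp: eventually_at_right_field intro: exI[of _ 1]\<close>)
    then show ?thesis by (simp add: S_def)
  qed
  show ?thesis
  proof (rule that[of \<alpha> "max 1 \<kappa>"])
    fix \<Xi> X and t :: real
    assume *: "continuous_on ?I \<Xi>" "\<Xi> ` ?I \<subseteq> sym_mats" "is_solution N A B \<mu> h \<Xi> X" "t \<ge> 0"
    let ?S = "SUP s\<in>?I. norm (\<Xi> s)"
    have "bdd_above ((\<lambda>s. norm (\<Xi> s)) ` ?I)"
      by (intro bounded_imp_bdd_above compact_imp_bounded compact_continuous_image
          continuous_on_norm *(1) compact_Icc)
    then have "norm (\<Xi> 0) \<le> ?S"
      using max_delay_nonneg[OF N h] by (intro cSUP_upper) auto
    then have "0 \<le> ?S" by (rule order_trans[OF norm_ge_zero])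
    then have "0 \<le> exp (- \<alpha> * t) * ?S" by simp
    then have "\<kappa> * (exp (- \<alpha> * t) * ?S) \<le> max 1 \<kappa> * (exp (- \<alpha> * t) * ?S)"
      by (intro mult_right_mono) auto
    with bound[OF *] show "norm (X t) \<le> max 1 \<kappa> * exp (- \<alpha> * t) * ?S"
      by (simp only: mult.assoc)
  qed (use \<alpha> in auto)
qed

lemma lmi_feasible_imp_exp_stable:
  fixes A B :: "nat \<Rightarrow> real^'n^'n"
  assumes N: "N \<ge> 1" and lmi: "lmi_feasible N A B \<mu>" and h: "\<forall>i\<in>{1..N}. 0 \<le> h i"
  shows "exp_stable N A B \<mu> h"
proof (rule symmetric_exponential_decay[OF N lmi h])
  fix \<alpha> \<beta>
  assume "\<alpha> > 0" "\<beta> \<ge> 1"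
    and decay: "\<And>\<Xi> X t. continuous_on {-max_delay N h..0} \<Xi> \<Longrightarrow>
      \<Xi> ` {-max_delay N h..0} \<subseteq> sym_mats \<Longrightarrow> is_solution N A B \<mu> h \<Xi> X \<Longrightarrow> t \<ge> 0 \<Longrightarrow>
      norm (X t) \<le> \<beta> * exp (- \<alpha> * t) * (SUP s\<in>{-max_delay N h..0}. norm (\<Xi> s))"
  show ?thesis
    unfolding exp_stable_def
  proof (rule exI[of _ \<alpha>], rule exI[of _ \<beta>], intro conjI allI impI)
    fix \<Xi> X and t :: real
    assume *: "continuous_on {-max_delay N h..0} \<Xi> \<and> \<Xi> ` {-max_delay N h..0} \<subseteq> psd_mats \<and>
      is_solution N A B \<mu> h \<Xi> X" and "t \<ge> 0"
    then have "\<Xi> ` {-max_delay N h..0} \<subseteq> sym_mats" by (auto simp: psd_mats_def)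
    with * \<open>t \<ge> 0\<close> show
      "norm (X t) \<le> \<beta> * exp (- \<alpha> * t) * (SUP s\<in>{-max_delay N h..0}. norm (\<Xi> s))"
      by (intro decay) auto
  qed fact+
qed

section \<open>Undelayed modes and the spectral conditions\<close>

lemma max_delay_zero: "N \<ge> 1 \<Longrightarrow> max_delay N (\<lambda>i. 0) = 0"
  by (simp add: max_delay_def image_constant_conv)

lemma is_solution_zero_delay:
  assumes "\<And>t. t \<ge> 0 \<Longrightarrow> (X has_vector_derivative opL N A B \<mu> (X t)) (at t within {0..})"
  shows "is_solution N A B \<mu> (\<lambda>i. 0) X X"
  using assms by (simp add: is_solution_def opL_def)

lemma no_exponential_lower_bound:
  fixes \<alpha> \<beta> :: real
  assumes "\<alpha> > 0" "\<beta> \<ge> 0" "\<And>t. t \<ge> 0 \<Longrightarrow> 1 \<le> \<beta> * exp (- \<alpha> * t)"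
  shows False
proof -
  \<comment> \<open>Evaluation at \<open>\<beta> / \<alpha>\<close> gives the impossible
    \<open>exp \<beta> \<le> \<beta>\<close>.\<close>
  have "1 \<le> \<beta> * exp (- \<beta>)" using assms(3)[of "\<beta> / \<alpha>"] assms(1,2) by simp
  then have "exp \<beta> \<le> \<beta>" by (simp add: exp_minus field_simps)
  then show False using exp_ge_add_one_self[of \<beta>] by simp
qed

text \<open>Stability speaks of semidefinite histories only, so the non-decaying mode must start
  from a semidefinite eigenvector.\<close>

lemma exp_stable_imp_lmi_feasible:
  fixes A B :: "nat \<Rightarrow> real^'n^'n"
  assumes N: "N \<ge> 1" and stable: "exp_stable N A B \<mu> (\<lambda>i. 0)"
  shows "lmi_feasible N A B \<mu>"
proof (rule ccontr)
  assume "\<not> lmi_feasible N A B \<mu>"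
  then obtain r X where r: "r \<ge> 0" and X: "X \<in> psd_mats" "X \<noteq> 0" "opL N A B \<mu> X = r *\<^sub>R X"
    by (rule opL_nonneg_eigenvector)
  define Y where "Y t = exp (r * t) *\<^sub>R X" for t
  have "(Y has_vector_derivative opL N A B \<mu> (Y t)) (at t within {0..})" for t
    unfolding Y_def linear_cmul[OF linear_opL] X(3) by (auto intro!: derivative_eq_intros)
  then have sol: "is_solution N A B \<mu> (\<lambda>i. 0) Y Y" by (intro is_solution_zero_delay)
  obtain \<alpha> \<beta> where \<alpha>: "\<alpha> > 0" "\<beta> \<ge> 1"
    and decay: "\<And>\<Xi> X t. continuous_on {0..0} \<Xi> \<Longrightarrow> \<Xi> ` {0..0} \<subseteq> psd_mats \<Longrightarrow>
      is_solution N A B \<mu> (\<lambda>i. 0) \<Xi> X \<Longrightarrow> t \<ge> 0 \<Longrightarrow>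
      norm (X t) \<le> \<beta> * exp (- \<alpha> * t) * (SUP s\<in>{0..0}. norm (\<Xi> s))"
    using stable unfolding exp_stable_def max_delay_zero[OF N] minus_zero by blast
  have "1 \<le> \<beta> * exp (- \<alpha> * t)" if "t \<ge> 0" for t
  proof -
    have "norm X \<le> exp (r * t) * norm X" using r that by (simp add: mult_le_cancel_right1)
    also have "\<dots> = norm (Y t)" by (simp add: Y_def)
    also have "\<dots> \<le> \<beta> * exp (- \<alpha> * t) * norm X"
      using decay[OF _ _ sol that] X(1) by (simp add: Y_def)
    finally show ?thesis using X(2) by simp
  qed
  with \<alpha> show False by (intro no_exponential_lower_bound[of \<alpha> \<beta>]) auto
qed

lemma lmi_feasible_imp_sp_complexified:
  fixes A B :: "nat \<Rightarrow> real^'n^'n"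
  assumes N: "N \<ge> 1" and lmi: "lmi_feasible N A B \<mu>"
  shows "sp_complexified (opL N A B \<mu>) \<subseteq> {z. Re z < 0}"
proof (rule ccontr)
  assume "\<not> ?thesis"
  then obtain z where z: "Re z \<ge> 0" and "z \<in> sp_complexified (opL N A B \<mu>)"
    unfolding subset_iff by (metis mem_Collect_eq not_less)
  then obtain X Y where sym: "X \<in> sym_mats" "Y \<in> sym_mats"
    and nz: "X \<noteq> 0 \<or> Y \<noteq> 0"
    and eig: "\<And>i j. Complex (opL N A B \<mu> X $ i $ j) (opL N A B \<mu> Y $ i $ j)
      = z * Complex (X $ i $ j) (Y $ i $ j)"
    unfolding sp_complexified_def by blast
  define a b where "a = Re z" and "b = Im z"
  \<comment> \<open>The sign is kept inside \<open>- X\<close> so that the pairs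
    \<open>(X, Y)\<close>, \<open>(Y, - X)\<close> and \<open>(- X, - Y)\<close>, which arise by
    multiplying the eigenvector by -i, share one pattern.\<close>
  have LX: "opL N A B \<mu> X = a *\<^sub>R X - b *\<^sub>R Y" and LY: "opL N A B \<mu> Y = a *\<^sub>R Y - b *\<^sub>R (- X)"
    using eig by (simp_all add: vec_eq_iff complex_eq_iff a_def b_def algebra_simps)
  have LmX: "opL N A B \<mu> (- X) = a *\<^sub>R (- X) - b *\<^sub>R (- Y)"
    by (simp add: linear_neg[OF linear_opL] LX)
  obtain \<alpha> \<beta> where \<alpha>: "\<alpha> > 0" "\<beta> \<ge> 1"
    and decay: "\<And>\<Xi> X t. continuous_on {0..0} \<Xi> \<Longrightarrow> \<Xi> ` {0..0} \<subseteq> sym_mats \<Longrightarrow>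
      is_solution N A B \<mu> (\<lambda>i. 0) \<Xi> X \<Longrightarrow> t \<ge> 0 \<Longrightarrow>
      norm (X t) \<le> \<beta> * exp (- \<alpha> * t) * (SUP s\<in>{0..0}. norm (\<Xi> s))"
    using symmetric_exponential_decay[OF N lmi, of "\<lambda>i. 0"]
    unfolding max_delay_zero[OF N] minus_zero by auto
  \<comment> \<open>The real part of \<open>exp (z t) (V + \<i> W)\<close>.\<close>
  define U where "U V W t = exp (a * t) *\<^sub>R (cos (b * t) *\<^sub>R V - sin (b * t) *\<^sub>R W)"
    for V W :: "real^'n^'n" and t
  have U: "norm (U V W t) \<le> \<beta> * exp (- \<alpha> * t) * norm V"
    if V: "V \<in> sym_mats" and LV: "opL N A B \<mu> V = a *\<^sub>R V - b *\<^sub>R W"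
      and LW: "opL N A B \<mu> W = a *\<^sub>R W - b *\<^sub>R (- V)" and t: "t \<ge> 0" for V W t
  proof -
    have "(U V W has_vector_derivative opL N A B \<mu> (U V W t)) (at t within {0..})" for t
      unfolding U_def linear_cmul[OF linear_opL] linear_diff[OF linear_opL] LV LW
      by (auto intro!: derivative_eq_intros simp: algebra_simps)
    then have "is_solution N A B \<mu> (\<lambda>i. 0) (U V W) (U V W)"
      by (intro is_solution_zero_delay)
    from decay[OF _ _ this t] V show ?thesis by (simp add: U_def)
  qed
  \<comment> \<open>A single \<open>U V W t\<close> may vanish at some times; rotating back by the
    angle \<open>b * t\<close> recovers \<open>exp (a * t) *\<^sub>R V\<close> from two of
    them.\<close>
  have half: "norm V \<le> \<beta> * exp (- \<alpha> * t) * (norm V + norm W)"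
    if V: "norm (U V W t) \<le> \<beta> * exp (- \<alpha> * t) * norm V"
      and W: "norm (U W (- V) t) \<le> \<beta> * exp (- \<alpha> * t) * norm W" and t: "t \<ge> 0" for V W t
  proof -
    have "exp (a * t) *\<^sub>R V = cos (b * t) *\<^sub>R U V W t + sin (b * t) *\<^sub>R U W (- V) t"
    proof -
      have "cos (b * t) *\<^sub>R U V W t + sin (b * t) *\<^sub>R U W (- V) t
          = (exp (a * t) * (cos (b * t))\<^sup>2) *\<^sub>R V + (exp (a * t) * (sin (b * t))\<^sup>2) *\<^sub>R V"
        unfolding U_def by (simp add: power2_eq_square algebra_simps)
      then show ?thesis by (simp flip: scaleR_add_left distrib_left)
    qed
    then have "norm (exp (a * t) *\<^sub>R V) \<le> norm (U V W t) + norm (U W (- V) t)"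
      by (auto intro!: order_trans[OF norm_triangle_ineq] add_mono mult_left_le_one_le)
    moreover have "norm V \<le> norm (exp (a * t) *\<^sub>R V)"
      using z t by (simp add: a_def mult_le_cancel_right1)
    ultimately show ?thesis using V W by (simp add: distrib_left)
  qed
  have "1 \<le> (2 * \<beta>) * exp (- \<alpha> * t)" if t: "t \<ge> 0" for t
  proof -
    have LmY: "opL N A B \<mu> (- Y) = a *\<^sub>R (- Y) - b *\<^sub>R X"
      by (simp add: linear_neg[OF linear_opL] LY)
    have 1: "norm (U X Y t) \<le> \<beta> * exp (- \<alpha> * t) * norm X"
      by (rule U[OF sym(1) LX LY t])
    have 2: "norm (U Y (- X) t) \<le> \<beta> * exp (- \<alpha> * t) * norm Y"
      by (rule U[OF sym(2) LY LmX t])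
    have 3: "norm (U (- X) (- Y) t) \<le> \<beta> * exp (- \<alpha> * t) * norm (- X)"
      by (rule U[OF sym_mats_minus[OF sym(1)] LmX _ t]) (simp add: LmY)
    have "norm X + norm Y \<le> 2 * \<beta> * exp (- \<alpha> * t) * (norm X + norm Y)"
      using half[OF 1 2 t] half[OF 2 3 t] by (simp add: algebra_simps)
    moreover have "norm X + norm Y > 0"
      using nz by (auto simp: add_pos_nonneg add_nonneg_pos)
    ultimately show ?thesis by (simp add: mult_le_cancel_right1)
  qed
  with \<alpha> show False by (intro no_exponential_lower_bound[of \<alpha> "2 * \<beta>"]) auto
qed

lemma sp_real_eigvec_subset:
  assumes "linear L"
  shows "sp_real_eigvec L \<subseteq> sp_complexified L"
proof
  fix z assume "z \<in> sp_real_eigvec L"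
  then obtain X where X: "X \<in> sym_mats" "X \<noteq> 0"
    "\<And>i j. complex_of_real (L X $ i $ j) = z * complex_of_real (X $ i $ j)"
    by (auto simp: sp_real_eigvec_def)
  then show "z \<in> sp_complexified L"
    unfolding sp_complexified_def
    by (intro CollectI bexI[OF _ X(1)] bexI[OF _ sym_mats_zero])
       (simp add: linear_0[OF assms] flip: complex_of_real_def)
qed

text \<open>The obstruction to feasibility is a real symmetric eigenvector, so it is visible already
  in the smaller set of eigenvalues.\<close>

lemma sp_real_eigvec_imp_lmi_feasible:
  fixes A B :: "nat \<Rightarrow> real^'n^'n"
  assumes "sp_real_eigvec (opL N A B \<mu>) \<subseteq> {z. Re z < 0}"
  shows "lmi_feasible N A B \<mu>"
proof (rule ccontr)
  assume "\<not> lmi_feasible N A B \<mu>"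
  then obtain r X where "r \<ge> 0" "X \<in> psd_mats" "X \<noteq> 0" "opL N A B \<mu> X = r *\<^sub>R X"
    by (rule opL_nonneg_eigenvector)
  then have "complex_of_real r \<in> sp_real_eigvec (opL N A B \<mu>)"
    by (auto simp: sp_real_eigvec_def psd_mats_def intro!: bexI[of _ X])
  with assms \<open>r \<ge> 0\<close> show False by auto
qed

theorem theorem3p6:
  fixes A B :: "nat \<Rightarrow> real^'n^'n" and \<mu> :: real and N :: nat
  assumes "N \<ge> 1"
  shows "((\<forall>h. (\<forall>i\<in>{1..N}. h i \<ge> 0) \<longrightarrow> exp_stable N A B \<mu> h)
            \<longleftrightarrow> exp_stable N A B \<mu> (\<lambda>i. 0)) \<and>
         (exp_stable N A B \<mu> (\<lambda>i. 0) \<longleftrightarrow> lmi_feasible N A B \<mu>) \<and>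
         (lmi_feasible N A B \<mu> \<longleftrightarrow>
            sp_complexified (\<lambda>X. opC N A \<mu> X + (\<Sum>i=1..N. opH B i X)) \<subseteq> {z. Re z < 0}) \<and>
         (lmi_feasible N A B \<mu> \<longleftrightarrow>
            sp_real_eigvec (\<lambda>X. opC N A \<mu> X + (\<Sum>i=1..N. opH B i X)) \<subseteq> {z. Re z < 0})"
proof -
  have eq: "(\<lambda>X. opC N A \<mu> X + (\<Sum>i=1..N. opH B i X)) = opL N A B \<mu>"
    by (simp add: opL_def fun_eq_iff)
  have stable_zero: "\<forall>h. (\<forall>i\<in>{1..N}. h i \<ge> 0) \<longrightarrow> exp_stable N A B \<mu> h \<Longrightarrow> exp_stable N A B \<mu> (\<lambda>i. 0)"
    by simp
  \<comment> \<open>Feasibility confines the larger spectrum, hence the smaller one, and confinement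
    of the smaller one gives feasibility back, so both readings of the spectral condition are
    equivalent to it.\<close>
  show ?thesis
    unfolding eq
    using stable_zero lmi_feasible_imp_exp_stable[OF assms, of A B \<mu>]
      exp_stable_imp_lmi_feasible[OF assms, of A B \<mu>]
      lmi_feasible_imp_sp_complexified[OF assms, of A B \<mu>]
      order_trans[OF sp_real_eigvec_subset[OF linear_opL, of N A B \<mu>], of "{z. Re z < 0}"]
      sp_real_eigvec_imp_lmi_feasible[of N A B \<mu>]
    by blast
qed

end
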